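(* Let $s=2$, $p=2$, $q\ge2$ and $n=p+q+1$. Put $$E=\begin{pmatrix}1&0\\0&1\\1&1\end{pmatrix},\qquad F=\begin{pmatrix}1&0&1\\1&1&0\end{pmatrix}.$$ Then the following $(p+q)\times n$ matrix $\mathcal{G}$ over $\mathrm{GF}(2)$, whose first $2$ rows form $\mathcal{G}_c$ and whose last $q$ rows form $\mathcal{G}_r$, yields a 2fi-optimal $2^{n-1}$ fractional factorial row-column design (in a $2^p\times 2^q$ array). (a) For $q=2$: $$\mathcal{G}=\left(\begin{array}{ccccc}1&1&0&1&1\\0&1&1&1&1\\ \hline 1&1&1&0&1\\1&0&1&1&1\end{array}\right).$$ (b) For $q=3$: $$\mathcal{G}=\left(\begin{array}{ccc} I_2 & F & \boldsymbol{1}_2\\ \hline E & I_3+EF & \boldsymbol{e}_3\end{array}\right).$$ (c) For $q=4$: $$\mathcal{G}=\left(\begin{array}{cccc} I_2 & F & \boldsymbol{1}_2 & \boldsymbol{e}_1\\ \hline E & I_3+EF & \boldsymbol{e}_1 & \boldsymbol{0}_{3\times1}\\ \boldsymbol{0}_{1\times2} & \boldsymbol{0}_{1\times3} & 1 & 1\end{array}\right).$$ (d) For $q\ge5$: $$\mathcal{G}=\left(\begin{array}{cccc} I_2 & F & \boldsymbol{1}_2 & X_*\\ \hline E & I_3+EF & \boldsymbol{1}_3 & \boldsymbol{0}_{3\times(q-3)}\\ \boldsymbol{0}_{(q-3)\times2} & \boldsymbol{0}_{(q-3)\times3} & \boldsymbol{1}_{q-3} & I_{q-3}\end{array}\right),$$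 where $X_*$ is a $2\times(q-3)$ matrix, with no zero column, selected so that each point of $\mathrm{PG}(1,2)$ appears among the columns of the $2\times n$ matrix $(I_2\;\;F\;\;\boldsymbol{1}_2\;\;X_* )$ either $\alpha$ or $\alpha+1$ times, where $\alpha=\lfloor n/3\rfloor$.
   Context: Matrices. $s$ is a prime (here $s=2$) and all matrices have entries in $\mathrm{GF}(s)=\mathbb{Z}/s$ (integers are reduced mod $s$). $I_v$ is the $v\times v$ identity, $\boldsymbol{1}_v$ the $v\times1$ all-ones vector, $\boldsymbol{0}_{v\times w}$ the zero matrix, and $\boldsymbol{e}_i$ the column vector (of the length dictated by its block) with $i$-th entry $1$ and other entries $0$. $\mathrm{PG}(m-1,s)$ is the set of 1-dimensional subspaces ("points") of $\mathrm{GF}(s)^m$; a nonzero column vector belongs to (is an appearance of) the point it spans. Designs. Let $p,q\ge1$, $p+q\le n$. An array generator matrix is a $(p+q)\times n$ matrix $\mathcal{G}$ over $\mathrm{GF}(s)$ of full row rank $p+q$; $\mathcal{G}_c$ denotes its first $p$ rows, $\mathcal{G}_r$ its last $q$ rows, and $\mathcal{G}_i,\mathcal{G}_{c,i},\mathcal{G}_{r,i}$ the $i$-th columns of $\mathcal{G},\mathcal{G}_c,\mathcal{G}_r$. If $\boldsymbol{x}_1,\dots,\boldsymbol{x}_{s^p}$ are the vectors of the row space of $\mathcal{G}_c$ and $\boldsymbol{y}_1,\dots,\boldsymbol{y}_{s^q}$ those of the row space of $\mathcal{G}_r$ (with $\boldsymbol{x}_1=\boldsymbol{y}_1=0$), $\mathcal{G}$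 yields the $s^p\times s^q$ row-column design whose cell $(i,j)$ carries the level combination $d[i,j]=\boldsymbol{x}_i+\boldsymbol{y}_j\in\mathrm{GF}(s)^n$ of the $n$ factors $F_1,\dots,F_n$. It is an $s^n$ full factorial design when $p+q=n$, and an $s^{n-k}$ fractional factorial design when $p+q=n-k<n$. Model and confounding. $Y_{ij}=\mu+\tau_i+\rho_j+\gamma_{d[i,j]}+\varepsilon_{ij}$, with row effects $\tau_i$, column effects $\rho_j$, uncorrelated mean-zero errors of variance $\sigma^2$, and $\gamma_{(x_1,\dots,x_n)}=\sum_l\alpha_{l,x_l}+\sum_{l<m}\sum_{v=1}^{s-1}\beta^{(v)}_{lm,\,x_l+vx_m}$, where $\sum_u\alpha_{l,u}=0$ and $\sum_u\beta^{(v)}_{lm,u}=0$. A main effect $F_l$ is unconfounded if the estimators of the $\alpha_{l,u}$ are uncorrelated with all other estimators in the model; the two-factor interaction (2fi) $F_l\times F_m$ is unconfounded if for every $v=1,\dots,s-1$ the estimators of the $\beta^{(v)}_{lm,u}$ are uncorrelated with all other estimators in the model. Interactions of three or more factors are assumed negligible. Equivalent algebraic criterion (known result, Zhou and Zhou 2023), usable as the definition of confounding. A main effect or 2fi is confounded with another main effect or 2fi iff the columns of $\mathcal{G}$ corresponding to the (distinct) factors involved in the two effects are linearly dependent. If $\mathcal{G}_i\ne0$, $F_i$ is confounded with column effects iff $\mathcal{G}_{c,i}=0$, and with row effects iff $\mathcal{G}_{r,i}=0$. If $\mathcal{G}_i,\mathcal{G}_j$ are linearly independent, $F_i\times F_j$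 is confounded with column effects iff $\mathcal{G}_{c,i},\mathcal{G}_{c,j}$ are linearly dependent, and with row effects iff $\mathcal{G}_{r,i},\mathcal{G}_{r,j}$ are linearly dependent. An effect is unconfounded iff none of these confoundings occurs. 2fi-optimality. The design yielded by $\mathcal{G}$ is 2fi-optimal if all main effects are unconfounded and the number of unconfounded 2fi's is maximum among all designs yielded by array generator matrices with the same $(s,p,q,n)$ for which all main effects are unconfounded. *)

theory Defs
  imports Jordan_Normal_Form.DL_Rank "HOL-Library.Z2" "HOL-Library.Cardinality"
begin

text \<open>
  GF(2) is the type \<^typ>\<open>bit\<close>; the general notions are stated over an arbitrary field.
  All indices (rows, columns, factors) start at 0.
\<close>

subsection \<open>Projective points\<close>

definition point_of :: "'a::field vec \<Rightarrow> 'a vec set" where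
  "point_of v = range (\<lambda>a. a \<cdot>\<^sub>v v)"

definition PG_points :: "nat \<Rightarrow> 'a::field vec set set" where
  "PG_points m = point_of ` (carrier_vec m - {0\<^sub>v m})"

definition appearances :: "'a::field vec set \<Rightarrow> 'a mat \<Rightarrow> nat" where
  "appearances P A =
     card {j. j < dim_col A \<and> col A j \<noteq> 0\<^sub>v (dim_row A) \<and> point_of (col A j) = P}"

subsection \<open>Array generator matrices and the designs they yield\<close>

definition column_part :: "nat \<Rightarrow> 'a mat \<Rightarrow> 'a mat" where
  "column_part p G = mat p (dim_col G) (\<lambda>(i, j). G $$ (i, j))"

definition row_part :: "nat \<Rightarrow> 'a mat \<Rightarrow> 'a mat" where
  "row_part p G = mat (dim_row G - p) (dim_col G) (\<lambda>(i, j). G $$ (p + i, j))"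

definition array_generator :: "nat \<Rightarrow> nat \<Rightarrow> nat \<Rightarrow> 'a::field mat \<Rightarrow> bool" where
  "array_generator p q n G \<longleftrightarrow>
     1 \<le> p \<and> 1 \<le> q \<and> p + q \<le> n \<and>
     G \<in> carrier_mat (p + q) n \<and> vec_space.rank (p + q) G = p + q"

text \<open>
  The array \<open>d\<close> is determined by \<open>G\<close> only up to the enumeration of the two row spaces,
  hence a relation rather than a function.
\<close>

definition yields_design ::
    "nat \<Rightarrow> nat \<Rightarrow> nat \<Rightarrow> 'a::field mat \<Rightarrow> (nat \<Rightarrow> nat \<Rightarrow> 'a vec) \<Rightarrow> bool" where
  "yields_design p q n G d \<longleftrightarrow>
     (\<exists>x y. bij_betw x {..<CARD('a) ^ p} (vec_space.row_space n (column_part p G)) \<and>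
            bij_betw y {..<CARD('a) ^ q} (vec_space.row_space n (row_part p G)) \<and>
            x 0 = 0\<^sub>v n \<and> y 0 = 0\<^sub>v n \<and>
            (\<forall>i<CARD('a) ^ p. \<forall>j<CARD('a) ^ q. d i j = x i + y j))"

subsection \<open>Confounding\<close>

text \<open>
  Linear dependence of the columns of \<open>A\<close> with indices in \<open>S\<close> as an indexed family: two equal
  columns with different indices are dependent.
\<close>

definition dependent_columns :: "'a::field mat \<Rightarrow> nat set \<Rightarrow> bool" where
  "dependent_columns A S \<longleftrightarrow>
     (\<exists>c. (\<exists>i\<in>S. c i \<noteq> 0) \<and> (\<forall>r<dim_row A. (\<Sum>i\<in>S. c i * A $$ (r, i)) = 0))"

datatype effect = Main_Effect nat | TwoFI nat nat

fun factors :: "effect \<Rightarrow> nat set" where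
  "factors (Main_Effect i) = {i}"
| "factors (TwoFI i j) = {i, j}"

definition twofis :: "nat \<Rightarrow> effect set" where
  "twofis n = {TwoFI i j | i j. i < j \<and> j < n}"

definition effects :: "nat \<Rightarrow> effect set" where
  "effects n = Main_Effect ` {..<n} \<union> twofis n"

definition confounded_with_effect :: "'a::field mat \<Rightarrow> effect \<Rightarrow> effect \<Rightarrow> bool" where
  "confounded_with_effect G e f \<longleftrightarrow> dependent_columns G (factors e \<union> factors f)"

text \<open>
  The next predicate is applied to the first \<open>p\<close> rows of \<open>G\<close> for column effects and to the last
  \<open>q\<close> rows for row effects.  The usual provisos (\<open>i\<close>-th column of \<open>G\<close> nonzero, respectively
  \<open>i\<close>-th and \<open>j\<close>-th columns of \<open>G\<close> independent) are immaterial below: if they fail, the effect is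
  already confounded with another main effect, as \<open>n \<ge> 2\<close>.
\<close>

fun confounded_within :: "'a::field mat \<Rightarrow> effect \<Rightarrow> bool" where
  "confounded_within B (Main_Effect i) \<longleftrightarrow> col B i = 0\<^sub>v (dim_row B)"
| "confounded_within B (TwoFI i j) \<longleftrightarrow> dependent_columns B {i, j}"

definition unconfounded :: "nat \<Rightarrow> 'a::field mat \<Rightarrow> effect \<Rightarrow> bool" where
  "unconfounded p G e \<longleftrightarrow>
     (\<forall>f\<in>effects (dim_col G). f \<noteq> e \<longrightarrow> \<not> confounded_with_effect G e f) \<and>
     \<not> confounded_within (column_part p G) e \<and>
     \<not> confounded_within (row_part p G) e"

subsection \<open>Optimality\<close>

definition main_effects_unconfounded :: "nat \<Rightarrow> 'a::field mat \<Rightarrow> bool" where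
  "main_effects_unconfounded p G \<longleftrightarrow> (\<forall>i<dim_col G. unconfounded p G (Main_Effect i))"

definition num_unconfounded_2fis :: "nat \<Rightarrow> 'a::field mat \<Rightarrow> nat" where
  "num_unconfounded_2fis p G = card {e \<in> twofis (dim_col G). unconfounded p G e}"

definition twofi_optimal :: "nat \<Rightarrow> nat \<Rightarrow> nat \<Rightarrow> 'a::field mat \<Rightarrow> bool" where
  "twofi_optimal p q n G \<longleftrightarrow>
     array_generator p q n G \<and> main_effects_unconfounded p G \<and>
     (\<forall>H :: 'a mat. array_generator p q n H \<and> main_effects_unconfounded p H \<longrightarrow>
        num_unconfounded_2fis p H \<le> num_unconfounded_2fis p G)"

definition yields_twofi_optimal_fraction ::
    "nat \<Rightarrow> nat \<Rightarrow> nat \<Rightarrow> nat \<Rightarrow> 'a::field mat \<Rightarrow> bool" where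
  "yields_twofi_optimal_fraction p q n k G \<longleftrightarrow>
     0 < k \<and> p + q + k = n \<and> (\<exists>d. yields_design p q n G d) \<and> twofi_optimal p q n G"

subsection \<open>The block matrices\<close>

definition append_cols :: "'a::zero mat \<Rightarrow> 'a mat \<Rightarrow> 'a mat" (infixr \<open>@\<^sub>c\<close> 66) where
  "A @\<^sub>c B = four_block_mat A B (0\<^sub>m 0 (dim_col A)) (0\<^sub>m 0 (dim_col B))"

definition ones_col :: "nat \<Rightarrow> 'a::one mat" where
  "ones_col m = mat m 1 (\<lambda>_. 1)"

text \<open>The argument \<open>i\<close> is the usual 1-based index of a standard basis vector.\<close>

definition e_col :: "nat \<Rightarrow> nat \<Rightarrow> 'a::zero_neq_one mat" where
  "e_col m i = mat m 1 (\<lambda>(r, _). if r + 1 = i then 1 else 0)"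

definition E_mat :: "bit mat" where
  "E_mat = mat_of_rows_list 2 [[1, 0], [0, 1], [1, 1]]"

definition F_mat :: "bit mat" where
  "F_mat = mat_of_rows_list 3 [[1, 0, 1], [1, 1, 0]]"

definition generator_a :: "bit mat" where
  "generator_a = mat_of_rows_list 5
     [[1, 1, 0, 1, 1],
      [0, 1, 1, 1, 1],
      [1, 1, 1, 0, 1],
      [1, 0, 1, 1, 1]]"

definition generator_b :: "bit mat" where
  "generator_b =
     (1\<^sub>m 2 @\<^sub>c F_mat @\<^sub>c ones_col 2) @\<^sub>r
     (E_mat @\<^sub>c (1\<^sub>m 3 + E_mat * F_mat) @\<^sub>c e_col 3 3)"

definition generator_c :: "bit mat" where
  "generator_c =
     (1\<^sub>m 2 @\<^sub>c F_mat @\<^sub>c ones_col 2 @\<^sub>c e_col 2 1) @\<^sub>r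
     (E_mat @\<^sub>c (1\<^sub>m 3 + E_mat * F_mat) @\<^sub>c e_col 3 1 @\<^sub>c 0\<^sub>m 3 1) @\<^sub>r
     (0\<^sub>m 1 2 @\<^sub>c 0\<^sub>m 1 3 @\<^sub>c 1\<^sub>m 1 @\<^sub>c 1\<^sub>m 1)"

definition generator_d :: "nat \<Rightarrow> bit mat \<Rightarrow> bit mat" where
  "generator_d q X =
     (1\<^sub>m 2 @\<^sub>c F_mat @\<^sub>c ones_col 2 @\<^sub>c X) @\<^sub>r
     (E_mat @\<^sub>c (1\<^sub>m 3 + E_mat * F_mat) @\<^sub>c ones_col 3 @\<^sub>c 0\<^sub>m 3 (q - 3)) @\<^sub>r
     (0\<^sub>m (q - 3) 2 @\<^sub>c 0\<^sub>m (q - 3) 3 @\<^sub>c ones_col (q - 3) @\<^sub>c 1\<^sub>m (q - 3))"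

definition admissible_X :: "nat \<Rightarrow> nat \<Rightarrow> bit mat \<Rightarrow> bool" where
  "admissible_X q n X \<longleftrightarrow>
     X \<in> carrier_mat 2 (q - 3) \<and> (\<forall>j<q - 3. col X j \<noteq> 0\<^sub>v 2) \<and>
     (\<forall>P\<in>PG_points 2. appearances P (1\<^sub>m 2 @\<^sub>c F_mat @\<^sub>c ones_col 2 @\<^sub>c X)
        \<in> {n div 3, n div 3 + 1})"

end

theory Submission
  imports Defs
begin

text \<open>
  Throughout, \<open>n = p + q + 1\<close>, so an array generator matrix has one column more than its rank: its
  columns satisfy exactly one nontrivial linear relation.  Over GF(2) a linear relation is the same
  thing as a set of column indices whose columns add up to zero, called a null set below.  A set of
  columns is dependent iff it contains a null set, so every confounding between two effects is
  decided by the single null set \<open>S\<close>: all main effects are unconfounded with one another and with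
  all 2fi's iff \<open>card S \<ge> 4\<close>; if \<open>card S \<ge> 5\<close> no two effects are confounded at all, and if
  \<open>card S = 4\<close> the six pairs inside \<open>S\<close> are confounded with their complements in \<open>S\<close>.  Confounding
  with rows and columns is a colouring problem: once all columns of the two parts are nonzero,
  \<open>F\<^sub>i \<times> F\<^sub>j\<close> is confounded with the column (row) effects iff columns \<open>i\<close> and \<open>j\<close> of the
  upper (lower) part coincide.  Hence if \<open>card S \<ge> 5\<close> the unconfounded 2fi's are exactly the pairs
  with different upper colours and different lower colours
  (\<open>unconfounded_pairs_if_null_sets_large\<close>).

  The upper part has only three possible colours, so the number of equally coloured pairs is least
  for a balanced colouring (\<open>card_equal_pairs_ge\<close>).  For \<open>q \<ge> 4\<close> the given generators attain this
  bound: their upper colouring is balanced, their lower columns are distinct, and \<open>card S \<ge> 5\<close>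
  (\<open>twofi_optimal_if_balanced\<close>).  For the two small cases the bound is not attainable and a finer
  argument is needed.

  \<^item> For \<open>q = 3\<close> the bound is \<open>15 - 3 = 12\<close>, and attaining it would require six distinct nonzero lower
    columns in \<open>GF(2)\<^sup>3\<close>, at least five of which add up to zero (\<open>card S = 4\<close> already costs six
    pairs).  The seven nonzero vectors add up to zero, so the one or two vectors left over would too,
    which is impossible.  The generator has 11 unconfounded 2fi's.
  \<^item> For \<open>q = 2\<close> and \<open>card S = 5\<close> the columns of either part add up to zero, which forces every
    colour class to be odd; then each part has at least three equally coloured pairs, and no pair is
    equally coloured in both, leaving at most \<open>10 - 3 - 3 = 4\<close>.  For \<open>card S = 4\<close> the six pairs
    inside \<open>S\<close> are lost, which leaves at most 4 as well.

  The generators for \<open>q \<ge> 3\<close> are instances of one bordered matrix, whose null set can be written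
  down explicitly (\<open>null_set_solution\<close>).  All its null sets contain one common index, and this
  alone gives full row rank and the design (\<open>array_generator_if_common_element\<close>).
\<close>

section \<open>Linear dependence over GF(2)\<close>

text \<open>
  The supports of the nonzero kernel vectors: over GF(2) a coefficient vector is determined by its
  support.
\<close>
definition null_set :: "bit mat \<Rightarrow> nat set \<Rightarrow> bool" where
  "null_set A S \<longleftrightarrow> S \<noteq> {} \<and> (\<forall>r<dim_row A. (\<Sum>i\<in>S. A $$ (r, i)) = 0)"

lemma dependent_columns_iff_null_set:
  fixes A :: "bit mat"
  assumes "finite T"
  shows "dependent_columns A T \<longleftrightarrow> (\<exists>S\<subseteq>T. null_set A S)"
proof
  assume "dependent_columns A T"
  then obtain c where c: "\<exists>i\<in>T. c i \<noteq> 0" "\<forall>r<dim_row A. (\<Sum>i\<in>T. c i * A $$ (r, i)) = 0"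
    unfolding dependent_columns_def by blast
  have "(\<Sum>i\<in>{i\<in>T. c i = 1}. A $$ (r, i)) = (\<Sum>i\<in>T. c i * A $$ (r, i))" for r
    by (rule sum.mono_neutral_cong_left) (use assms in auto)
  with c show "\<exists>S\<subseteq>T. null_set A S"
    unfolding null_set_def by (intro exI[of _ "{i\<in>T. c i = 1}"]) auto
next
  assume "\<exists>S\<subseteq>T. null_set A S"
  then obtain S where S: "S \<subseteq> T" "null_set A S" by blast
  have "(\<Sum>i\<in>T. of_bool (i \<in> S) * A $$ (r, i)) = (\<Sum>i\<in>S. A $$ (r, i))" for r
    by (rule sum.mono_neutral_cong_right) (use assms S in auto)
  with S show "dependent_columns A T"
    unfolding null_set_def dependent_columns_def
    by (intro exI[of _ "\<lambda>i. of_bool (i \<in> S)"]) auto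
qed

lemma UNIV_bit: "(UNIV :: bit set) = {0, 1}"
  by (auto intro: bit.exhaust)

lemma bit_add_eq_0_iff: "a + b = 0 \<longleftrightarrow> a = (b :: bit)"
  by (cases a; cases b) auto

lemma null_set_singleton:
  assumes "i < dim_col A"
  shows "null_set A {i} \<longleftrightarrow> col A i = 0\<^sub>v (dim_row A)"
  using assms by (auto simp: null_set_def vec_eq_iff)

lemma null_set_pair:
  assumes "i \<noteq> j" "i < dim_col A" "j < dim_col A"
  shows "null_set A {i, j} \<longleftrightarrow> col A i = col A j"
  using assms by (auto simp: null_set_def vec_eq_iff bit_add_eq_0_iff)

lemma dependent_columns_pair:
  fixes A :: "bit mat"
  assumes "i \<noteq> j" "i < dim_col A" "j < dim_col A"
    and "col A i \<noteq> 0\<^sub>v (dim_row A)" "col A j \<noteq> 0\<^sub>v (dim_row A)"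
  shows "dependent_columns A {i, j} \<longleftrightarrow> col A i = col A j"
proof -
  have "(\<exists>S\<subseteq>{i, j}. null_set A S) \<longleftrightarrow>
      null_set A {} \<or> null_set A {i} \<or> null_set A {j} \<or> null_set A {i, j}"
    by (auto simp: Pow_insert insert_commute simp flip: Pow_iff)
  then show ?thesis
    using assms by (simp add: dependent_columns_iff_null_set null_set_singleton null_set_pair)
      (simp add: null_set_def)
qed

section \<open>Counting pairs of equal colour\<close>

text \<open>Pairs of factors are listed in increasing order, matching the indexing of 2fi's.\<close>
definition pairs_within :: "nat set \<Rightarrow> (nat \<times> nat) set" where
  "pairs_within S = {(i, j). i \<in> S \<and> j \<in> S \<and> i < j}"

definition equal_pairs :: "(nat \<Rightarrow> 'b) \<Rightarrow> nat \<Rightarrow> (nat \<times> nat) set" where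
  "equal_pairs f n = {(i, j) \<in> pairs_within {..<n}. f i = f j}"

lemma finite_pairs_within [simp]: "finite S \<Longrightarrow> finite (pairs_within S)"
  by (rule finite_subset[of _ "S \<times> S"]) (auto simp: pairs_within_def)

lemma equal_pairs_subset: "equal_pairs f n \<subseteq> pairs_within {..<n}"
  by (auto simp: equal_pairs_def)

lemma finite_equal_pairs [simp]: "finite (equal_pairs f n)"
  by (rule finite_subset[OF equal_pairs_subset]) simp

text \<open>The square of \<open>S\<close> splits into increasing pairs, decreasing pairs and the diagonal.\<close>
lemma card_pairs_within:
  assumes "finite S"
  shows "2 * card (pairs_within S) + card S = (card S)\<^sup>2"
proof -
  let ?diag = "(\<lambda>i. (i, i)) ` S"
  have "pairs_within S \<inter> (prod.swap ` pairs_within S \<union> ?diag) = {}"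
    "prod.swap ` pairs_within S \<inter> ?diag = {}"
    by (auto simp: pairs_within_def)
  moreover have "S \<times> S = pairs_within S \<union> (prod.swap ` pairs_within S \<union> ?diag)"
    by (auto simp: pairs_within_def image_iff)
  ultimately have "card (S \<times> S) =
      card (pairs_within S) + (card (prod.swap ` pairs_within S) + card ?diag)"
    using assms by (simp add: card_Un_disjoint)
  moreover have "card (prod.swap ` pairs_within S) = card (pairs_within S)"
    by (rule card_image) (rule inj_onI, auto)
  moreover have "card ?diag = card S"
    by (rule card_image) (auto simp: inj_on_def)
  ultimately show ?thesis by (simp add: card_cartesian_product power2_eq_square)
qed

lemma sum_card_fibres:
  assumes "finite V" "f ` {..<n} \<subseteq> V"
  shows "(\<Sum>v\<in>V. card {j. j < (n::nat) \<and> f j = v}) = n"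
proof -
  have "(\<Sum>v\<in>V. \<Sum>j\<in>{j \<in> {..<n}. f j = v}. 1) = (\<Sum>j\<in>{..<n}. (1::nat))"
    by (rule sum.group) (use assms in auto)
  then show ?thesis by simp
qed

lemma card_equal_pairs:
  assumes "finite V" "f ` {..<n} \<subseteq> V"
  shows "2 * card (equal_pairs f n) + n = (\<Sum>v\<in>V. (card {j. j < n \<and> f j = v})\<^sup>2)"
proof -
  let ?F = "\<lambda>v. {j. j < n \<and> f j = v}"
  have "equal_pairs f n = (\<Union>v\<in>V. pairs_within (?F v))"
    using assms by (auto simp: equal_pairs_def pairs_within_def)
  moreover have "card (\<Union>v\<in>V. pairs_within (?F v)) = (\<Sum>v\<in>V. card (pairs_within (?F v)))"
    by (rule card_UN_disjoint, use assms in simp, simp, auto simp: pairs_within_def)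
  ultimately have "2 * card (equal_pairs f n) + n
      = (\<Sum>v\<in>V. 2 * card (pairs_within (?F v)) + card (?F v))"
    using sum_card_fibres[OF assms] by (simp add: sum.distrib sum_distrib_left)
  also have "\<dots> = (\<Sum>v\<in>V. (card (?F v))\<^sup>2)"
    by (rule sum.cong) (auto intro: card_pairs_within)
  finally show ?thesis .
qed

text \<open>
  For an integer \<open>x\<close> and a natural number \<open>a\<close> we have \<open>(x - a) * (x - (a + 1)) \<ge> 0\<close>, with equality
  iff \<open>x\<close> is \<open>a\<close> or \<open>a + 1\<close>.  Summing over the class sizes, whose sum is \<open>n\<close>, bounds the sum of
  their squares from below; the bound is attained by balanced colourings.
\<close>
lemma card_equal_pairs_ge:
  fixes a :: nat
  assumes V: "finite V" "f ` {..<n} \<subseteq> V"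
  shows "2 * a * n \<le> 2 * card (equal_pairs f n) + card V * a * (a + 1)"
    and "(\<And>v. v \<in> V \<Longrightarrow> card {j. j < n \<and> f j = v} \<in> {a, a + 1}) \<Longrightarrow>
      2 * a * n = 2 * card (equal_pairs f n) + card V * a * (a + 1)"
proof -
  let ?k = "\<lambda>v. int (card {j. j < n \<and> f j = v})"
  have "(\<Sum>v\<in>V. (?k v - a) * (?k v - (a + 1)))
      = (\<Sum>v\<in>V. (?k v)\<^sup>2) - (2 * a + 1) * (\<Sum>v\<in>V. ?k v) + card V * a * (a + 1)"
    by (simp add: sum.distrib sum_subtractf sum_distrib_left power2_eq_square algebra_simps)
  also have "(\<Sum>v\<in>V. ?k v) = n"
    using sum_card_fibres[OF V] by (metis of_nat_sum)
  also have "(\<Sum>v\<in>V. (?k v)\<^sup>2) = 2 * card (equal_pairs f n) + n"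
    using card_equal_pairs[OF V] by (simp flip: of_nat_power of_nat_sum)
  finally have eq: "(\<Sum>v\<in>V. (?k v - a) * (?k v - (a + 1)))
      = int (2 * card (equal_pairs f n) + card V * a * (a + 1)) - int (2 * a * n)"
    by (simp add: algebra_simps)
  have "0 \<le> (\<Sum>v\<in>V. (?k v - a) * (?k v - (a + 1)))"
  proof (rule sum_nonneg)
    show "0 \<le> (?k v - a) * (?k v - (a + 1))" for v
      by (cases "?k v \<le> a") (auto intro: mult_nonneg_nonneg mult_nonpos_nonpos)
  qed
  with eq show "2 * a * n \<le> 2 * card (equal_pairs f n) + card V * a * (a + 1)"
    by linarith
  assume "\<And>v. v \<in> V \<Longrightarrow> card {j. j < n \<and> f j = v} \<in> {a, a + 1}"
  then have "(\<Sum>v\<in>V. (?k v - a) * (?k v - (a + 1))) = 0"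
    by (intro sum.neutral) force
  with eq show "2 * a * n = 2 * card (equal_pairs f n) + card V * a * (a + 1)"
    by linarith
qed

text \<open>
  The same argument with \<open>(x - 1) * (x - 3) \<ge> 0\<close>, which holds for every odd \<open>x\<close> (it fails only at
  \<open>x = 2\<close> among the natural numbers).
\<close>
lemma card_equal_pairs_odd:
  assumes V: "finite V" "f ` {..<n} \<subseteq> V" and odd: "\<And>v. v \<in> V \<Longrightarrow> odd (card {j. j < n \<and> f j = v})"
  shows "3 * n \<le> 2 * card (equal_pairs f n) + 3 * card V"
proof -
  let ?k = "\<lambda>v. card {j. j < n \<and> f j = v}"
  have "4 * ?k v \<le> (?k v)\<^sup>2 + 3" if "v \<in> V" for v
  proof -
    have "?k v = 1 \<or> 3 \<le> ?k v" using odd[OF that] by presburger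
    then have "?k v = 1 \<or> (\<exists>m. ?k v = 3 + m)" using le_Suc_ex by blast
    then show ?thesis by (auto simp: power2_eq_square algebra_simps)
  qed
  then have "(\<Sum>v\<in>V. 4 * ?k v) \<le> (\<Sum>v\<in>V. (?k v)\<^sup>2 + 3)" by (rule sum_mono)
  then show ?thesis
    using sum_card_fibres[OF V] card_equal_pairs[OF V]
    by (simp add: sum.distrib flip: sum_distrib_left)
qed

section \<open>Null sets and colours decide confounding\<close>

definition unconfounded_pairs :: "nat \<Rightarrow> 'a::field mat \<Rightarrow> (nat \<times> nat) set" where
  "unconfounded_pairs p G = {(i, j) \<in> pairs_within {..<dim_col G}. unconfounded p G (TwoFI i j)}"

lemma num_unconfounded_2fis_eq: "num_unconfounded_2fis p G = card (unconfounded_pairs p G)"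
proof -
  have "{e \<in> twofis (dim_col G). unconfounded p G e} =
      (\<lambda>(i, j). TwoFI i j) ` unconfounded_pairs p G"
    by (auto simp: twofis_def unconfounded_pairs_def pairs_within_def image_iff)
  also have "card \<dots> = card (unconfounded_pairs p G)"
    by (rule card_image) (auto simp: inj_on_def)
  finally show ?thesis unfolding num_unconfounded_2fis_def .
qed

text \<open>The two colours of a factor: its columns in the upper and in the lower part of the matrix.\<close>
abbreviation col_point :: "nat \<Rightarrow> 'a mat \<Rightarrow> nat \<Rightarrow> 'a vec" where
  "col_point p G \<equiv> col (column_part p G)"

abbreviation row_point :: "nat \<Rightarrow> 'a mat \<Rightarrow> nat \<Rightarrow> 'a vec" where
  "row_point p G \<equiv> col (row_part p G)"

lemma dim_parts [simp]:
  "dim_row (column_part p G) = p" "dim_col (column_part p G) = dim_col G"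
  "dim_row (row_part p G) = dim_row G - p" "dim_col (row_part p G) = dim_col G"
  by (auto simp: column_part_def row_part_def)

lemma all_rows_split:
  assumes "p \<le> (m::nat)"
  shows "(\<forall>r<m. P r) \<longleftrightarrow> (\<forall>r<p. P r) \<and> (\<forall>r<m - p. P (p + r))"
proof safe
  fix r assume *: "\<forall>r<p. P r" "\<forall>r<m - p. P (p + r)" "r < m"
  show "P r"
  proof (cases "r < p")
    case False
    then have "P (p + (r - p))" using * by (intro *(2)[rule_format]) auto
    then show ?thesis using False by simp
  qed (use * in auto)
qed (use assms in auto)

lemma null_set_parts:
  assumes "p \<le> dim_row G" "S \<subseteq> {..<dim_col G}"
  shows "null_set G S \<longleftrightarrow> null_set (column_part p G) S \<and> null_set (row_part p G) S"
proof -
  have "(\<Sum>i\<in>S. column_part p G $$ (r, i)) = (\<Sum>i\<in>S. G $$ (r, i))" if "r < p" for r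
    by (rule sum.cong) (use that assms in \<open>auto simp: column_part_def\<close>)
  moreover have "(\<Sum>i\<in>S. row_part p G $$ (r, i)) = (\<Sum>i\<in>S. G $$ (p + r, i))"
    if "r < dim_row G - p" for r
    by (rule sum.cong) (use that assms in \<open>auto simp: row_part_def\<close>)
  ultimately show ?thesis
    unfolding null_set_def all_rows_split[OF assms(1)] by auto
qed

lemma main_effects_nonzero:
  assumes "main_effects_unconfounded p G" "j < dim_col G"
  shows "col_point p G j \<noteq> 0\<^sub>v p" "row_point p G j \<noteq> 0\<^sub>v (dim_row G - p)"
  using assms by (auto simp: main_effects_unconfounded_def unconfounded_def)

text \<open>
  Any three factors are the factors of a main effect and a 2fi, so no three columns may be dependent.
\<close>
lemma main_effects_null_set_card:
  fixes G :: "bit mat"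
  assumes main: "main_effects_unconfounded p G" and "3 \<le> dim_col G"
    and S: "null_set G S" "S \<subseteq> {..<dim_col G}"
  shows "4 \<le> card S"
proof (rule ccontr)
  assume "\<not> 4 \<le> card S"
  then have "\<exists>T. S \<subseteq> T \<and> T \<subseteq> {..<dim_col G} \<and> card T = 3"
    by (intro exists_subset_between) (use assms in auto)
  then obtain T where T: "S \<subseteq> T" "T \<subseteq> {..<dim_col G}" "card T = 3" by blast
  then obtain i j k where ijk: "T = {i, j, k}" "i \<noteq> j" "i \<noteq> k" "j < k"
    unfolding card_3_iff by (metis insert_commute linorder_neqE_nat)
  have "confounded_with_effect G (Main_Effect i) (TwoFI j k)"
    unfolding confounded_with_effect_def
    by (subst dependent_columns_iff_null_set) (use S T ijk in auto)
  moreover have "TwoFI j k \<in> effects (dim_col G)"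
    using T ijk by (auto simp: effects_def twofis_def)
  ultimately have "\<not> unconfounded p G (Main_Effect i)"
    by (auto simp: unconfounded_def)
  then show False
    using main T ijk by (auto simp: main_effects_unconfounded_def)
qed

lemma confounded_within_pair:
  fixes A :: "bit mat"
  assumes "i < j" "j < dim_col A"
    and "col A i \<noteq> 0\<^sub>v (dim_row A)" "col A j \<noteq> 0\<^sub>v (dim_row A)"
  shows "confounded_within A (TwoFI i j) \<longleftrightarrow> col A i = col A j"
  using assms by (simp add: dependent_columns_pair)

lemma unconfounded_pairs_subset:
  fixes G :: "bit mat"
  assumes "main_effects_unconfounded p G"
  shows "unconfounded_pairs p G \<subseteq> pairs_within {..<dim_col G} -
    (equal_pairs (col_point p G) (dim_col G) \<union> equal_pairs (row_point p G) (dim_col G))"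
proof clarsimp
  fix i j assume ij: "(i, j) \<in> unconfounded_pairs p G"
  then have *: "i < j" "j < dim_col G" by (auto simp: unconfounded_pairs_def pairs_within_def)
  have "\<not> confounded_within (column_part p G) (TwoFI i j)"
    "\<not> confounded_within (row_part p G) (TwoFI i j)"
    using ij by (auto simp: unconfounded_pairs_def unconfounded_def)
  then have "col_point p G i \<noteq> col_point p G j" "row_point p G i \<noteq> row_point p G j"
    using * main_effects_nonzero[OF assms]
    by (auto simp: confounded_within_pair simp del: confounded_within.simps)
  with * show "(i, j) \<in> pairs_within {..<dim_col G} \<and>
     (i, j) \<notin> equal_pairs (col_point p G) (dim_col G) \<and>
     (i, j) \<notin> equal_pairs (row_point p G) (dim_col G)"
    by (auto simp: equal_pairs_def pairs_within_def)
qed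

text \<open>Two complementary pairs inside a null set of size 4 are confounded with each other.\<close>
lemma unconfounded_pairs_null_set_4:
  fixes G :: "bit mat"
  assumes S: "null_set G S" "S \<subseteq> {..<dim_col G}" "card S = 4"
  shows "unconfounded_pairs p G \<subseteq> pairs_within {..<dim_col G} - pairs_within S"
proof -
  have "finite S" using S finite_subset by blast
  have False if ij: "(i, j) \<in> unconfounded_pairs p G" "i \<in> S" "j \<in> S" "i < j" for i j
  proof -
    have "card (S - {i, j}) = 2" using ij S \<open>finite S\<close> by (simp add: card_Diff_subset)
    then obtain k l where kl: "S - {i, j} = {k, l}" "k < l"
      by (metis card_2_iff insert_commute linorder_neqE_nat)
    then have Seq: "S = {i, j, k, l}" and "k \<noteq> i" using ij by blast+
    have "confounded_with_effect G (TwoFI i j) (TwoFI k l)"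
      unfolding confounded_with_effect_def
      by (subst dependent_columns_iff_null_set) (use S Seq in auto)
    moreover have "TwoFI k l \<in> effects (dim_col G)"
      using S kl Seq by (auto simp: effects_def twofis_def)
    ultimately show False
      using ij \<open>k \<noteq> i\<close> by (auto simp: unconfounded_pairs_def unconfounded_def)
  qed
  then show ?thesis by (auto simp: pairs_within_def unconfounded_pairs_def)
qed

lemma card_unconfounded_pairs_null_set_4:
  fixes G :: "bit mat"
  assumes S: "null_set G S" "S \<subseteq> {..<dim_col G}" "card S = 4"
  shows "card (unconfounded_pairs p G) + 6 \<le> card (pairs_within {..<dim_col G})"
proof -
  have "finite S" using S finite_subset by blast
  have sub: "pairs_within S \<subseteq> pairs_within {..<dim_col G}"
    using S by (auto simp: pairs_within_def)
  have "2 * card (pairs_within S) + 4 = 4\<^sup>2"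
    using card_pairs_within[OF \<open>finite S\<close>] S by simp
  then have "card (pairs_within S) = 6" by simp
  moreover have "card (unconfounded_pairs p G) \<le> card (pairs_within {..<dim_col G} - pairs_within S)"
    by (rule card_mono) (use unconfounded_pairs_null_set_4[OF S] in auto)
  moreover have "card (pairs_within {..<dim_col G} - pairs_within S)
      = card (pairs_within {..<dim_col G}) - card (pairs_within S)"
    by (rule card_Diff_subset) (use sub \<open>finite S\<close> in auto)
  moreover have "card (pairs_within S) \<le> card (pairs_within {..<dim_col G})"
    by (rule card_mono) (use sub in auto)
  ultimately show ?thesis by linarith
qed

text \<open>A pair that agrees in both parts would be a null set of size 2.\<close>
lemma equal_pairs_parts_disjoint:
  fixes G :: "bit mat"
  assumes main: "main_effects_unconfounded p G" and "3 \<le> dim_col G" "p \<le> dim_row G"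
  shows "equal_pairs (col_point p G) (dim_col G) \<inter> equal_pairs (row_point p G) (dim_col G) = {}"
proof -
  have False if "i < j" "j < dim_col G" "col_point p G i = col_point p G j"
    "row_point p G i = row_point p G j" for i j
  proof -
    \<comment> \<open>Equal columns add up to zero in characteristic 2.\<close>
    have "null_set G {i, j}"
      using that assms by (subst null_set_parts[of p]) (auto simp: null_set_pair)
    then have "4 \<le> card {i, j}"
      by (rule main_effects_null_set_card[OF main \<open>3 \<le> dim_col G\<close>]) (use that in auto)
    then show False by (simp add: card_insert_if split: if_splits)
  qed
  then show ?thesis by (auto simp: equal_pairs_def pairs_within_def)
qed

lemma card_unconfounded_pairs_le:
  fixes G :: "bit mat"
  assumes main: "main_effects_unconfounded p G" and "3 \<le> dim_col G" "p \<le> dim_row G"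
  shows "card (unconfounded_pairs p G) + card (equal_pairs (col_point p G) (dim_col G))
    + card (equal_pairs (row_point p G) (dim_col G)) \<le> card (pairs_within {..<dim_col G})"
proof -
  let ?c = "equal_pairs (col_point p G) (dim_col G)"
  let ?r = "equal_pairs (row_point p G) (dim_col G)"
  note sub = unconfounded_pairs_subset[OF main]
  have fin: "finite (unconfounded_pairs p G)" by (rule finite_subset[OF sub]) simp
  have "card (unconfounded_pairs p G) + (card ?c + card ?r) = card (unconfounded_pairs p G \<union> (?c \<union> ?r))"
    using equal_pairs_parts_disjoint[OF assms] sub fin
    by (subst card_Un_disjoint, simp, simp, blast, subst card_Un_disjoint) auto
  also have "\<dots> \<le> card (pairs_within {..<dim_col G})"
    by (rule card_mono) (use sub equal_pairs_subset in auto)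
  finally show ?thesis by simp
qed

text \<open>
  Two effects involve at most four factors, so null sets of size at least 5 exclude every confounding
  between effects and only the two colourings matter.
\<close>
lemma unconfounded_pairs_if_null_sets_large:
  fixes G :: "bit mat"
  assumes large: "\<And>S. null_set G S \<Longrightarrow> S \<subseteq> {..<dim_col G} \<Longrightarrow> 5 \<le> card S"
    and nz: "\<And>j. j < dim_col G \<Longrightarrow> col_point p G j \<noteq> 0\<^sub>v p"
      "\<And>j. j < dim_col G \<Longrightarrow> row_point p G j \<noteq> 0\<^sub>v (dim_row G - p)"
  shows "main_effects_unconfounded p G"
    and "unconfounded_pairs p G = pairs_within {..<dim_col G} -
      (equal_pairs (col_point p G) (dim_col G) \<union> equal_pairs (row_point p G) (dim_col G))"
proof -
  have no: "\<not> confounded_with_effect G e f" if "e \<in> effects (dim_col G)" "f \<in> effects (dim_col G)" for e f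
  proof
    assume "confounded_with_effect G e f"
    moreover have fin: "finite (factors e)" "finite (factors f)" "card (factors e) \<le> 2" "card (factors f) \<le> 2"
      "factors e \<subseteq> {..<dim_col G}" "factors f \<subseteq> {..<dim_col G}"
      using that by (auto simp: effects_def twofis_def card_insert_if)
    ultimately obtain S where S: "S \<subseteq> factors e \<union> factors f" "null_set G S"
      unfolding confounded_with_effect_def by (subst (asm) dependent_columns_iff_null_set) auto
    then have "card S \<le> card (factors e) + card (factors f)"
      using fin by (meson card_Un_le card_mono finite_UnI le_trans)
    moreover have "5 \<le> card S" using S fin by (intro large) auto
    ultimately show False using fin by linarith
  qed
  show main: "main_effects_unconfounded p G"
    unfolding main_effects_unconfounded_def unconfounded_def
    using no nz by (auto simp: effects_def)
  have "unconfounded p G (TwoFI i j)" if "i < j" "j < dim_col G"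
    "col_point p G i \<noteq> col_point p G j" "row_point p G i \<noteq> row_point p G j" for i j
    unfolding unconfounded_def using that nz no
    by (subst (1 2) confounded_within_pair) (auto simp: effects_def twofis_def)
  then have "pairs_within {..<dim_col G} -
      (equal_pairs (col_point p G) (dim_col G) \<union> equal_pairs (row_point p G) (dim_col G))
    \<subseteq> unconfounded_pairs p G"
    by (auto simp: pairs_within_def equal_pairs_def unconfounded_pairs_def)
  with unconfounded_pairs_subset[OF main]
  show "unconfounded_pairs p G = pairs_within {..<dim_col G} -
      (equal_pairs (col_point p G) (dim_col G) \<union> equal_pairs (row_point p G) (dim_col G))"
    by blast
qed

section \<open>Full rank and the existence of the design\<close>

lemma bit_eq_iff_one: "a = b \<longleftrightarrow> (a = 1 \<longleftrightarrow> b = (1 :: bit))"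
  by (cases a; cases b) auto

lemma sum_bit_sym_diff:
  fixes f :: "nat \<Rightarrow> bit"
  assumes "finite S" "finite T" "sum f S = sum f T"
  shows "sum f ((S - T) \<union> (T - S)) = 0"
proof -
  have "sum f S = sum f (S - T) + sum f (S \<inter> T)" "sum f T = sum f (T - S) + sum f (S \<inter> T)"
    using assms by (metis sum.Int_Diff add.commute, metis sum.Int_Diff add.commute Int_commute)
  then have "sum f (S - T) + sum f (S \<inter> T) = sum f (T - S) + sum f (S \<inter> T)"
    using assms by metis
  then have "sum f (S - T) = sum f (T - S)" by (rule add_right_imp_eq)
  moreover have "sum f ((S - T) \<union> (T - S)) = sum f (S - T) + sum f (T - S)"
    by (rule sum.union_disjoint) (use assms in auto)
  ultimately show ?thesis by (simp add: bit_add_eq_0_iff)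
qed

text \<open>In characteristic 2, two sets of columns with the same sum differ by a null set.\<close>
lemma null_set_sym_diff:
  assumes "finite S" "finite T" "S \<noteq> T"
    and "\<And>r. r < dim_row A \<Longrightarrow> (\<Sum>i\<in>S. A $$ (r, i)) = (\<Sum>i\<in>T. A $$ (r, i))"
  shows "null_set A ((S - T) \<union> (T - S))"
  unfolding null_set_def using assms by (auto intro!: sum_bit_sym_diff)

text \<open>
  The sum of a set of columns, encoded as the set of rows in which it is 1.  Linear questions thereby
  become counting questions about maps between power sets.
\<close>
definition subset_sum :: "bit mat \<Rightarrow> nat set \<Rightarrow> nat set" where
  "subset_sum A S = {r. r < dim_row A \<and> (\<Sum>i\<in>S. A $$ (r, i)) = 1}"

lemma inj_on_subset_sum:
  assumes "finite J" "\<And>S. S \<subseteq> J \<Longrightarrow> \<not> null_set A S"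
  shows "inj_on (subset_sum A) (Pow J)"
proof (rule inj_onI, rule ccontr)
  fix S T assume *: "S \<in> Pow J" "T \<in> Pow J" "subset_sum A S = subset_sum A T" "S \<noteq> T"
  have "(\<Sum>i\<in>S. A $$ (r, i)) = (\<Sum>i\<in>T. A $$ (r, i))" if "r < dim_row A" for r
  proof -
    have "r \<in> subset_sum A S \<longleftrightarrow> r \<in> subset_sum A T" using *(3) by simp
    then show ?thesis using that by (subst bit_eq_iff_one) (simp add: subset_sum_def)
  qed
  then have "null_set A ((S - T) \<union> (T - S))"
    using * assms(1) by (intro null_set_sym_diff) (auto intro: finite_subset)
  moreover have "(S - T) \<union> (T - S) \<subseteq> J" using * by auto
  ultimately show False using assms(2) by blast
qed

text \<open>Pigeonhole: there are more sets of columns than possible sums.\<close>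
lemma ex_null_set:
  assumes "dim_row A < dim_col A"
  obtains S where "S \<subseteq> {..<dim_col A}" "null_set A S"
proof (rule ccontr)
  assume "\<not> thesis"
  then have "inj_on (subset_sum A) (Pow {..<dim_col A})"
    using that by (intro inj_on_subset_sum) auto
  moreover have "subset_sum A ` Pow {..<dim_col A} \<subseteq> Pow {..<dim_row A}"
    by (auto simp: subset_sum_def)
  ultimately have "card (Pow {..<dim_col A}) \<le> card (Pow {..<dim_row A})"
    by (meson card_inj_on_le finite_Pow_iff finite_lessThan)
  then show False using assms by (simp add: card_Pow)
qed

text \<open>
  Omitting column \<open>j0\<close> leaves \<open>m\<close> columns without a null set; their \<open>2 ^ m\<close> subsets have distinct
  sums and hence reach all \<open>2 ^ m\<close> values.
\<close>
lemma subset_sum_surj: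
  assumes A: "A \<in> carrier_mat m (Suc m)" and "j0 < Suc m"
    and j0: "\<And>S. S \<subseteq> {..<Suc m} \<Longrightarrow> null_set A S \<Longrightarrow> j0 \<in> S"
  shows "subset_sum A ` Pow {..<Suc m} = Pow {..<m}"
proof
  show le: "subset_sum A ` Pow {..<Suc m} \<subseteq> Pow {..<m}"
    using A by (auto simp: subset_sum_def)
  let ?J = "{..<Suc m} - {j0}"
  have "inj_on (subset_sum A) (Pow ?J)"
    using j0 by (intro inj_on_subset_sum) auto
  then have "card (subset_sum A ` Pow ?J) = card (Pow {..<m})"
    using \<open>j0 < Suc m\<close> by (simp add: card_image card_Pow)
  moreover have "subset_sum A ` Pow ?J \<subseteq> Pow {..<m}" using le by blast
  ultimately have "subset_sum A ` Pow ?J = Pow {..<m}"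
    by (intro card_subset_eq) auto
  moreover have "subset_sum A ` Pow ?J \<subseteq> subset_sum A ` Pow {..<Suc m}"
    by (intro image_mono Pow_mono) auto
  ultimately show "Pow {..<m} \<subseteq> subset_sum A ` Pow {..<Suc m}" by simp
qed

lemma rank_full_if_subset_sum_surj:
  assumes A: "A \<in> carrier_mat m n" and surj: "subset_sum A ` Pow {..<n} = Pow {..<m}"
  shows "vec_space.rank m A = m"
proof -
  interpret vec_space "TYPE(bit)" m .
  have "\<exists>x\<in>carrier_vec n. A *\<^sub>v x = v" if v: "v \<in> carrier_vec m" for v
  proof -
    have "{r. r < m \<and> v $ r = 1} \<in> subset_sum A ` Pow {..<n}"
      unfolding surj by auto
    then obtain S where S: "S \<subseteq> {..<n}" "{r. r < m \<and> v $ r = 1} = subset_sum A S" by blast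
    have "(A *\<^sub>v vec n (\<lambda>j. of_bool (j \<in> S))) $ r = v $ r" if "r < m" for r
    proof -
      have "(A *\<^sub>v vec n (\<lambda>j. of_bool (j \<in> S))) $ r = (\<Sum>j<n. A $$ (r, j) * of_bool (j \<in> S))"
        using A that by (auto simp: scalar_prod_def atLeast0LessThan intro!: sum.cong)
      also have "\<dots> = (\<Sum>j\<in>S. A $$ (r, j))"
        by (rule sum.mono_neutral_cong_right) (use S in auto)
      also have "\<dots> = v $ r"
      proof -
        have "r \<in> {r. r < m \<and> v $ r = 1} \<longleftrightarrow> r \<in> subset_sum A S" using S(2) by simp
        then show ?thesis using that A by (subst bit_eq_iff_one) (simp add: subset_sum_def)
      qed
      finally show ?thesis .
    qed
    then show ?thesis
      using v A by (intro bexI[of _ "vec n (\<lambda>j. of_bool (j \<in> S))"] eq_vecI) auto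
  qed
  then have "col_space A = carrier_vec m"
    unfolding col_space_eq[OF A] using A by auto
  then have "span_vs (set (cols A)) = V"
    unfolding col_space_def by (simp add: module_vec_def)
  then show ?thesis
    unfolding rank_def using dim_is_n by simp
qed

text \<open>
  If some rows added up to zero, then every combination of columns would have coordinate sum zero on
  these rows; but a unit vector is such a combination.
\<close>
lemma no_null_set_transpose:
  assumes A: "A \<in> carrier_mat m n" and surj: "subset_sum A ` Pow {..<n} = Pow {..<m}"
    and R: "R \<subseteq> {..<m}"
  shows "\<not> null_set A\<^sup>T R"
proof
  assume null: "null_set A\<^sup>T R"
  then obtain r where r: "r \<in> R" by (auto simp: null_set_def)
  have "{r} \<in> subset_sum A ` Pow {..<n}" unfolding surj using r R by auto
  then obtain S where S: "S \<subseteq> {..<n}" "{r} = subset_sum A S" by blast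
  have s: "(\<Sum>j\<in>S. A $$ (i, j)) = of_bool (i = r)" if "i < m" for i
    using S(2) that A unfolding subset_sum_def set_eq_iff by (auto split: if_splits)
  have "(\<Sum>i\<in>R. A $$ (i, j)) = 0" if "j \<in> S" for j
  proof -
    have "j < n" using that S by auto
    then have "(\<Sum>i\<in>R. A\<^sup>T $$ (j, i)) = 0" using null A by (auto simp: null_set_def)
    moreover have "(\<Sum>i\<in>R. A\<^sup>T $$ (j, i)) = (\<Sum>i\<in>R. A $$ (i, j))"
      by (rule sum.cong) (use R A \<open>j < n\<close> in auto)
    ultimately show ?thesis by simp
  qed
  then have "0 = (\<Sum>j\<in>S. \<Sum>i\<in>R. A $$ (i, j))" by simp
  also have "\<dots> = (\<Sum>i\<in>R. \<Sum>j\<in>S. A $$ (i, j))" by (rule sum.swap)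
  also have "\<dots> = (\<Sum>i\<in>R. of_bool (i = r))"
    by (rule sum.cong) (use s R in auto)
  also have "\<dots> = 1"
    using r R by (simp add: of_bool_def finite_subset[OF R])
  finally show False by simp
qed

text \<open>Independent rows have \<open>2 ^ p\<close> distinct combinations.\<close>
lemma card_row_space:
  assumes P: "P \<in> carrier_mat p n" and indep: "\<And>R. R \<subseteq> {..<p} \<Longrightarrow> \<not> null_set P\<^sup>T R"
  shows "card (vec_space.row_space n P) = 2 ^ p" "0\<^sub>v n \<in> vec_space.row_space n P"
proof -
  interpret vec_space "TYPE(bit)" n .
  let ?h = "\<lambda>R. vec n (\<lambda>j. \<Sum>i\<in>R. P $$ (i, j))"
  have "inj_on ?h (Pow {..<p})"
  proof (rule inj_onI)
    fix S T assume *: "S \<in> Pow {..<p}" "T \<in> Pow {..<p}" "?h S = ?h T"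
    have "subset_sum P\<^sup>T S = subset_sum P\<^sup>T T"
    proof -
      have "(\<Sum>i\<in>R. P\<^sup>T $$ (j, i)) = ?h R $ j" if "R \<in> Pow {..<p}" "j < n" for R j
        using that P by (auto intro!: sum.cong)
      then have "(\<Sum>i\<in>S. P\<^sup>T $$ (j, i)) = (\<Sum>i\<in>T. P\<^sup>T $$ (j, i))" if "j < n" for j
        using that * by metis
      then show ?thesis using P by (auto simp: subset_sum_def)
    qed
    with * inj_on_subset_sum[of "{..<p}" "P\<^sup>T"] indep show "S = T"
      by (auto dest: inj_onD)
  qed
  moreover have rs: "row_space P = ?h ` Pow {..<p}"
  proof (intro equalityI subsetI)
    fix w assume "w \<in> row_space P"
    then obtain y where y: "y \<in> carrier_vec p" "P\<^sup>T *\<^sub>v y = w"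
      unfolding row_space_eq[OF P] using P by auto
    have "w = ?h {i. i < p \<and> y $ i = 1}"
    proof (rule eq_vecI)
      fix j assume "j < dim_vec (?h {i. i < p \<and> y $ i = 1})"
      then have j: "j < n" by simp
      have "w $ j = (\<Sum>i<p. P $$ (i, j) * y $ i)"
        using y P j by (auto simp: scalar_prod_def atLeast0LessThan intro!: sum.cong)
      also have "\<dots> = (\<Sum>i\<in>{i. i < p \<and> y $ i = 1}. P $$ (i, j))"
        by (rule sum.mono_neutral_cong_right) auto
      finally show "w $ j = ?h {i. i < p \<and> y $ i = 1} $ j" using j by simp
    qed (use y P in auto)
    then show "w \<in> ?h ` Pow {..<p}" by blast
  next
    fix w assume "w \<in> ?h ` Pow {..<p}"
    then obtain R where R: "R \<subseteq> {..<p}" "w = ?h R" by blast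
    have "P\<^sup>T *\<^sub>v vec p (\<lambda>i. of_bool (i \<in> R)) = w"
    proof (rule eq_vecI)
      fix j assume "j < dim_vec w"
      then have j: "j < n" using R by simp
      have "(P\<^sup>T *\<^sub>v vec p (\<lambda>i. of_bool (i \<in> R))) $ j = (\<Sum>i<p. P $$ (i, j) * of_bool (i \<in> R))"
        using P j by (auto simp: scalar_prod_def atLeast0LessThan intro!: sum.cong)
      also have "\<dots> = (\<Sum>i\<in>R. P $$ (i, j))"
        by (rule sum.mono_neutral_cong_right) (use R in auto)
      finally show "(P\<^sup>T *\<^sub>v vec p (\<lambda>i. of_bool (i \<in> R))) $ j = w $ j" using R j by simp
    qed (use R P in auto)
    then show "w \<in> row_space P"
      unfolding row_space_eq[OF P] using P R(2) by force
  qed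
  ultimately show "card (row_space P) = 2 ^ p"
    by (simp add: card_image card_Pow)
  show "0\<^sub>v n \<in> row_space P"
    unfolding rs by (rule image_eqI[of _ _ "{}"]) (auto intro: eq_vecI)
qed

lemma ex_bij_betw_starting_at:
  assumes "card A = N" "0 < N" "a \<in> A"
  shows "\<exists>x. bij_betw x {..<N} A \<and> x 0 = a"
proof -
  have "finite A" using assms card_ge_0_finite by auto
  then obtain h where h: "bij_betw h {..<N} A"
    using assms(1) ex_bij_betw_nat_finite[of A] by (auto simp: atLeast0LessThan)
  then obtain k where k: "k < N" "h k = a"
    using assms(3) unfolding bij_betw_def by blast
  have "bij_betw (Transposition.transpose 0 k) {..<N} {..<N}"
    by (rule bij_betw_byWitness[where f' = "Transposition.transpose 0 k"])
      (use k assms in \<open>auto simp: Transposition.transpose_def\<close>)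
  then have "bij_betw (h \<circ> Transposition.transpose 0 k) {..<N} A"
    using h by (rule bij_betw_trans)
  then show ?thesis using k by (intro exI[of _ "h \<circ> Transposition.transpose 0 k"]) auto
qed

lemma card_bit: "CARD(bit) = 2"
  using UNIV_bit by (metis card_2_iff zero_neq_one)

text \<open>
  Full row rank of the matrix passes to both of its parts, so the two row spaces have the sizes
  \<open>2 ^ p\<close> and \<open>2 ^ q\<close> of the array.
\<close>
lemma array_generator_if_common_element:
  assumes G: "G \<in> carrier_mat (p + q) n" and n: "n = p + q + 1" and pq: "1 \<le> p" "1 \<le> q"
    and "j0 < n" and j0: "\<And>S. S \<subseteq> {..<n} \<Longrightarrow> null_set G S \<Longrightarrow> j0 \<in> S"
  shows "array_generator p q n G" "\<exists>d. yields_design p q n G d"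
proof -
  have surj: "subset_sum G ` Pow {..<n} = Pow {..<p + q}"
    using subset_sum_surj[of G "p + q" j0] G n \<open>j0 < n\<close> j0 by auto
  then show "array_generator p q n G"
    unfolding array_generator_def
    using G n pq rank_full_if_subset_sum_surj[OF G surj] by auto
  have c: "\<not> null_set (column_part p G)\<^sup>T R" if R: "R \<subseteq> {..<p}" for R
  proof
    assume "null_set (column_part p G)\<^sup>T R"
    moreover have "(\<Sum>i\<in>R. (column_part p G)\<^sup>T $$ (j, i)) = (\<Sum>i\<in>R. G\<^sup>T $$ (j, i))" if "j < n" for j
      by (rule sum.cong) (use that R G in \<open>auto simp: column_part_def\<close>)
    ultimately have "null_set G\<^sup>T R" using G by (auto simp: null_set_def)
    moreover have "R \<subseteq> {..<p + q}" using R by force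
    ultimately show False using no_null_set_transpose[OF G surj] by blast
  qed
  have r: "\<not> null_set (row_part p G)\<^sup>T R" if R: "R \<subseteq> {..<q}" for R
  proof
    assume "null_set (row_part p G)\<^sup>T R"
    moreover have "(\<Sum>i\<in>R. (row_part p G)\<^sup>T $$ (j, i)) = (\<Sum>i\<in>(+) p ` R. G\<^sup>T $$ (j, i))" if "j < n" for j
      unfolding sum.reindex[OF inj_on_add]
      by (rule sum.cong) (use that R G in \<open>auto simp: row_part_def\<close>)
    ultimately have "null_set G\<^sup>T ((+) p ` R)" using G by (auto simp: null_set_def)
    moreover have "(+) p ` R \<subseteq> {..<p + q}" using R by force
    ultimately show False using no_null_set_transpose[OF G surj] by blast
  qed
  have "column_part p G \<in> carrier_mat p n" "row_part p G \<in> carrier_mat q n"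
    using G by (auto simp: column_part_def row_part_def)
  note * = card_row_space[OF this(1) c] card_row_space[OF this(2) r]
  obtain x where x: "bij_betw x {..<(2::nat) ^ p} (vec_space.row_space n (column_part p G))" "x 0 = 0\<^sub>v n"
    using ex_bij_betw_starting_at[OF *(1) _ *(2)] by auto
  obtain y where y: "bij_betw y {..<(2::nat) ^ q} (vec_space.row_space n (row_part p G))" "y 0 = 0\<^sub>v n"
    using ex_bij_betw_starting_at[OF *(3) _ *(4)] by auto
  show "\<exists>d. yields_design p q n G d"
    unfolding yields_design_def card_bit
    by (rule exI[of _ "\<lambda>i j. x i + y j"]) (use x y in blast)
qed

section \<open>Upper bounds for arbitrary designs\<close>

definition vec2 :: "bit \<Rightarrow> bit \<Rightarrow> bit vec" where
  "vec2 a b = vec 2 (\<lambda>r. if r = 0 then a else b)"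

lemma vec2_simps [simp]:
  "vec2 a b \<in> carrier_vec 2" "vec2 a b $ 0 = a" "vec2 a b $ Suc 0 = b"
  by (auto simp: vec2_def)

lemma vec2_eqI:
  assumes "v \<in> carrier_vec 2" "v $ 0 = a" "v $ 1 = b"
  shows "v = vec2 a b"
  using assms by (intro eq_vecI) (auto simp: vec2_def less_2_cases_iff)

lemma vec2_eq_iff [simp]: "vec2 a b = vec2 c d \<longleftrightarrow> a = c \<and> b = d"
  by (metis vec2_simps(2,3))

lemma zero_vec2: "0\<^sub>v 2 = vec2 0 0"
  by (rule vec2_eqI) auto

lemma nonzero_vecs_2:
  "carrier_vec 2 - {0\<^sub>v 2} = {vec2 1 0, vec2 0 1, vec2 1 1}"
proof (rule Set.set_eqI)
  fix v
  show "v \<in> carrier_vec 2 - {0\<^sub>v 2} \<longleftrightarrow> v \<in> {vec2 1 0, vec2 0 1, vec2 1 1}"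
  proof (cases "v \<in> carrier_vec 2")
    case True
    then obtain a b where "v = vec2 a b" using vec2_eqI by blast
    then show ?thesis unfolding zero_vec2 by (cases a; cases b) auto
  qed auto
qed

lemma card_nonzero_vecs_2: "card (carrier_vec 2 - {0\<^sub>v 2 :: bit vec}) = 3"
  unfolding nonzero_vecs_2 by simp

lemma finite_nonzero_vecs_2: "finite (carrier_vec 2 - {0\<^sub>v 2 :: bit vec})"
  unfolding nonzero_vecs_2 by simp

lemma sum_bit_eq_0_iff:
  fixes f :: "'b \<Rightarrow> bit"
  assumes "finite S"
  shows "sum f S = 0 \<longleftrightarrow> even (card {x \<in> S. f x = 1})"
proof -
  have "sum f S = (\<Sum>x\<in>{x \<in> S. f x = 1}. 1)"
    by (rule sum.mono_neutral_cong_right) (use assms in auto)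
  also have "\<dots> = of_nat (card {x \<in> S. f x = 1})" by simp
  also have "of_nat m = (0 :: bit) \<longleftrightarrow> even m" for m
  proof (induction m)
    case (Suc m)
    then show ?case by (cases "of_nat m :: bit") auto
  qed simp
  finally show ?thesis .
qed

text \<open>
  The points \<open>(1, 0)\<close>, \<open>(0, 1)\<close>, \<open>(1, 1)\<close> occur \<open>a\<close>, \<open>b\<close>, \<open>c\<close> times.  The two coordinate sums make
  \<open>a + c\<close> and \<open>b + c\<close> even, so \<open>a\<close>, \<open>b\<close>, \<open>c\<close> have equal parity; as their sum is odd, so are they.
\<close>
lemma odd_fibres:
  fixes f :: "nat \<Rightarrow> bit vec"
  assumes f: "f ` {..<n} \<subseteq> carrier_vec 2 - {0\<^sub>v 2}" and "odd n"
    and sum: "\<And>r. r < 2 \<Longrightarrow> (\<Sum>j<n. f j $ r) = 0"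
    and v: "v \<in> carrier_vec 2 - {0\<^sub>v 2}"
  shows "odd (card {j. j < n \<and> f j = v})"
proof -
  let ?k = "\<lambda>v. card {j. j < n \<and> f j = v}"
  let ?a = "vec2 1 0"
  let ?b = "vec2 0 1"
  let ?c = "vec2 1 1"
  have abc: "f j $ 0 = 1 \<longleftrightarrow> f j = ?a \<or> f j = ?c" "f j $ 1 = 1 \<longleftrightarrow> f j = ?b \<or> f j = ?c"
    if "j < n" for j
  proof -
    have "f j = ?a \<or> f j = ?b \<or> f j = ?c"
      using f that unfolding nonzero_vecs_2 by blast
    then show "f j $ 0 = 1 \<longleftrightarrow> f j = ?a \<or> f j = ?c" "f j $ 1 = 1 \<longleftrightarrow> f j = ?b \<or> f j = ?c"
      by auto
  qed
  have "{j \<in> {..<n}. f j $ 0 = 1} = {j. j < n \<and> f j = ?a} \<union> {j. j < n \<and> f j = ?c}"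
    using abc by blast
  moreover have "card ({j. j < n \<and> f j = ?a} \<union> {j. j < n \<and> f j = ?c}) = ?k ?a + ?k ?c"
    by (rule card_Un_disjoint) auto
  ultimately have "card {j \<in> {..<n}. f j $ 0 = 1} = ?k ?a + ?k ?c" by simp
  then have 0: "even (?k ?a + ?k ?c)"
    using sum[of 0] by (simp add: sum_bit_eq_0_iff)
  have "{j \<in> {..<n}. f j $ 1 = 1} = {j. j < n \<and> f j = ?b} \<union> {j. j < n \<and> f j = ?c}"
    using abc by blast
  moreover have "card ({j. j < n \<and> f j = ?b} \<union> {j. j < n \<and> f j = ?c}) = ?k ?b + ?k ?c"
    by (rule card_Un_disjoint) auto
  ultimately have "card {j \<in> {..<n}. f j $ 1 = 1} = ?k ?b + ?k ?c" by simp
  then have 1: "even (?k ?b + ?k ?c)"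
    using sum[of 1] by (simp add: sum_bit_eq_0_iff)
  have "?k ?a + (?k ?b + ?k ?c) = n"
    using sum_card_fibres[OF finite_nonzero_vecs_2 f]
    unfolding nonzero_vecs_2 by simp
  with 0 1 \<open>odd n\<close> have "odd (?k ?a)" "odd (?k ?b)" "odd (?k ?c)"
    by presburger+
  then show ?thesis using v unfolding nonzero_vecs_2 by auto
qed

lemma points_in_nonzero_vectors:
  assumes "main_effects_unconfounded p G"
  shows "col_point p G ` {..<dim_col G} \<subseteq> carrier_vec p - {0\<^sub>v p}"
    and "row_point p G ` {..<dim_col G} \<subseteq> carrier_vec (dim_row G - p) - {0\<^sub>v (dim_row G - p)}"
  by (intro image_subsetI DiffI carrier_vecI; use main_effects_nonzero[OF assms] in simp)+

lemma null_set_sum_col: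
  assumes "null_set A S" "S \<subseteq> {..<dim_col A}" "r < dim_row A"
  shows "(\<Sum>j\<in>S. col A j $ r) = 0"
proof -
  have "(\<Sum>j\<in>S. col A j $ r) = (\<Sum>j\<in>S. A $$ (r, j))"
    by (rule sum.cong) (use assms in auto)
  then show ?thesis using assms by (simp add: null_set_def)
qed

text \<open>
  Either the null set has size 4 and its six pairs are lost, or it consists of all five factors and
  the parity argument costs three pairs in each part.
\<close>
lemma card_unconfounded_pairs_2_by_2:
  fixes H :: "bit mat"
  assumes H: "H \<in> carrier_mat 4 5" and main: "main_effects_unconfounded 2 H"
  shows "card (unconfounded_pairs 2 H) \<le> 4"
proof -
  have dim: "dim_row H = 4" "dim_col H = 5" using H by auto
  have ten: "card (pairs_within {..<5}) = 10"
    using card_pairs_within[of "{..<5}"] by simp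
  obtain S where S: "S \<subseteq> {..<5}" "null_set H S"
    using ex_null_set[of H] dim by auto
  have "4 \<le> card S"
    using main_effects_null_set_card[OF main _ S(2)] S dim by auto
  moreover have "card S \<le> 5" using card_mono[OF _ S(1)] by simp
  ultimately consider "card S = 4" | "card S = 5" by linarith
  then show ?thesis
  proof cases
    case 1
    then show ?thesis
      using card_unconfounded_pairs_null_set_4[of H S 2] S dim ten by simp
  next
    case 2
    then have "S = {..<5}" using S card_subset_eq[of "{..<5}" S] by auto
    then have null: "null_set (column_part 2 H) {..<5}" "null_set (row_part 2 H) {..<5}"
      using null_set_parts[of 2 H S] S dim by auto
    have "3 \<le> card (equal_pairs f 5)"
      if f: "f ` {..<5} \<subseteq> carrier_vec 2 - {0\<^sub>v 2 :: bit vec}"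
        and "\<And>r. r < 2 \<Longrightarrow> (\<Sum>j<5. f j $ r) = 0" for f
      using card_equal_pairs_odd[OF finite_nonzero_vecs_2 f odd_fibres[OF f]] that(2)
      by (simp add: card_nonzero_vecs_2)
    then have "3 \<le> card (equal_pairs (col_point 2 H) 5)" "3 \<le> card (equal_pairs (row_point 2 H) 5)"
      using points_in_nonzero_vectors[OF main] null_set_sum_col[OF null(1)] null_set_sum_col[OF null(2)] dim
      by auto
    then show ?thesis
      using card_unconfounded_pairs_le[OF main] dim ten by simp
  qed
qed

text \<open>
  The seven nonzero vectors of \<open>GF(2)\<^sup>3\<close> add up to zero.  Hence the complement of a zero-sum
  set of 5 or 6 of them is a zero-sum set of size 2 or 1, and no such set exists.
\<close>
lemma no_null_5_or_6_in_Fano_plane: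
  fixes t :: "nat \<Rightarrow> bit \<times> bit \<times> bit"
  assumes inj: "inj_on t S" and nz: "\<And>j. j \<in> S \<Longrightarrow> t j \<noteq> (0, 0, 0)"
    and card: "card S = 5 \<or> card S = 6"
    and sum: "(\<Sum>j\<in>S. fst (t j)) = 0" "(\<Sum>j\<in>S. fst (snd (t j))) = 0" "(\<Sum>j\<in>S. snd (snd (t j))) = 0"
  shows False
proof -
  have U: "(UNIV :: (bit \<times> bit \<times> bit) set) = {0, 1} \<times> {0, 1} \<times> {0, 1}"
    using UNIV_bit by (metis UNIV_Times_UNIV)
  define W where "W = UNIV - {(0 :: bit, 0 :: bit, 0 :: bit)}"
  have W: "W = {(0,0,1), (0,1,0), (0,1,1), (1,0,0), (1,0,1), (1,1,0), (1,1,1)}"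
    unfolding W_def U by auto
  have "card (t ` S) = card S" using inj by (rule card_image)
  moreover have sub: "t ` S \<subseteq> W" by (intro image_subsetI) (simp add: W_def nz)
  ultimately have "card (W - t ` S) = 7 - card S"
    by (subst card_Diff_subset) (auto simp: W intro: finite_subset)
  then have D: "card (W - t ` S) = 1 \<or> card (W - t ` S) = 2" using card by auto
  have "sum g (W - t ` S) = 0" if "sum g W = 0" "sum (\<lambda>j. g (t j)) S = 0"
    for g :: "bit \<times> bit \<times> bit \<Rightarrow> bit"
  proof -
    have "sum g W = sum g (W - t ` S) + sum g (t ` S)"
      by (rule sum.subset_diff[OF sub]) (simp add: W)
    also have "sum g (t ` S) = sum (\<lambda>j. g (t j)) S"
      using sum.reindex[OF inj, of g] by simp
    finally show ?thesis using that by simp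
  qed
  then have s: "sum fst (W - t ` S) = 0" "sum (\<lambda>w. fst (snd w)) (W - t ` S) = 0"
    "sum (\<lambda>w. snd (snd w)) (W - t ` S) = 0"
    using sum by (simp_all add: W)
  from D show False
  proof
    assume "card (W - t ` S) = 1"
    then obtain w where w: "W - t ` S = {w}" by (auto simp: card_1_singleton_iff)
    then have "w = (0, 0, 0)" using s by (simp add: prod_eq_iff)
    moreover have "w \<in> W" using w by blast
    ultimately show False by (simp add: W_def)
  next
    assume "card (W - t ` S) = 2"
    then obtain v w where vw: "W - t ` S = {v, w}" "v \<noteq> w" by (auto simp: card_2_iff)
    have "fst v = fst w" "fst (snd v) = fst (snd w)" "snd (snd v) = snd (snd w)"
      using s vw by (simp_all, (subst bit_eq_iff_one, simp)+)
    then show False using vw by (simp add: prod_eq_iff)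
  qed
qed

text \<open>
  Three pairs always share a point of the upper part.  If the null set has at least five elements, the
  lower columns cannot all be distinct, and a coincidence there costs a fourth pair.
\<close>
lemma card_unconfounded_pairs_2_by_3:
  fixes H :: "bit mat"
  assumes H: "H \<in> carrier_mat 5 6" and main: "main_effects_unconfounded 2 H"
  shows "card (unconfounded_pairs 2 H) \<le> 11"
proof -
  have dim: "dim_row H = 5" "dim_col H = 6" using H by auto
  have fifteen: "card (pairs_within {..<6}) = 15"
    using card_pairs_within[of "{..<6}"] by simp
  obtain S where S: "S \<subseteq> {..<6}" "null_set H S"
    using ex_null_set[of H] dim by auto
  have "4 \<le> card S"
    using main_effects_null_set_card[OF main _ S(2)] S dim by auto
  moreover have "card S \<le> 6" using card_mono[OF _ S(1)] by simp
  ultimately consider "card S = 4" | "card S = 5 \<or> card S = 6" by linarith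
  then show ?thesis
  proof cases
    case 1
    then show ?thesis
      using card_unconfounded_pairs_null_set_4[of H S 2] S dim fifteen by simp
  next
    case 2
    \<comment> \<open>Six factors on three points: the balanced class size is 2.\<close>
    have "2 * 2 * 6 \<le> 2 * card (equal_pairs (col_point 2 H) 6) + 3 * 2 * (2 + 1)"
      using card_equal_pairs_ge(1)[OF finite_nonzero_vecs_2, of "col_point 2 H" 6 2]
        points_in_nonzero_vectors[OF main] dim
      by (simp add: card_nonzero_vecs_2)
    moreover have "equal_pairs (row_point 2 H) 6 \<noteq> {}"
    proof
      assume none: "equal_pairs (row_point 2 H) 6 = {}"
      \<comment> \<open>Coordinate triples form a finite type, so the nonzero ones can be listed.\<close>
      define t where "t j = (row_point 2 H j $ 0, row_point 2 H j $ 1, row_point 2 H j $ 2)" for j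
      have t_eqD: "row_point 2 H i = row_point 2 H j" if "t i = t j" for i j
        using that dim by (auto simp: t_def numeral_3_eq_3 less_Suc_eq numeral_2_eq_2 intro!: eq_vecI)
      have "inj_on t S"
      proof (rule linorder_inj_onI')
        fix i j assume "i \<in> S" "j \<in> S" "i < j"
        then have "(i, j) \<in> pairs_within {..<6}" using S by (auto simp: pairs_within_def)
        then have "row_point 2 H i \<noteq> row_point 2 H j"
          using none unfolding equal_pairs_def by blast
        then show "t i \<noteq> t j" using t_eqD by blast
      qed
      moreover have "t j \<noteq> (0, 0, 0)" if "j \<in> S" for j
      proof
        assume "t j = (0, 0, 0)"
        then have "row_point 2 H j = 0\<^sub>v 3"
          using dim by (auto simp: t_def numeral_3_eq_3 less_Suc_eq numeral_2_eq_2 intro!: eq_vecI)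
        then show False
          using main_effects_nonzero(2)[OF main, of j] dim S that by auto
      qed
      moreover have "null_set (row_part 2 H) S"
        using null_set_parts[of 2 H S] S dim by auto
      note null_set_sum_col[OF this]
      ultimately show False
        using no_null_5_or_6_in_Fano_plane[of t S] 2 S dim by (auto simp: t_def)
    qed
    then have "1 \<le> card (equal_pairs (row_point 2 H) 6)"
      by (simp add: Suc_le_eq card_gt_0_iff)
    ultimately show ?thesis
      using card_unconfounded_pairs_le[OF main] dim fifteen by simp
  qed
qed

text \<open>
  For any competitor, pairs of equal upper colour are confounded; here they are the only ones, and
  there are as few of them as possible.
\<close>
lemma twofi_optimal_if_balanced:
  fixes G :: "bit mat"
  assumes gen: "array_generator 2 q n G"
    and large: "\<And>S. null_set G S \<Longrightarrow> S \<subseteq> {..<n} \<Longrightarrow> 5 \<le> card S"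
    and nz: "\<And>j. j < n \<Longrightarrow> col_point 2 G j \<noteq> 0\<^sub>v 2" "\<And>j. j < n \<Longrightarrow> row_point 2 G j \<noteq> 0\<^sub>v q"
    and inj: "inj_on (row_point 2 G) {..<n}"
    and balanced: "\<And>v. v \<in> carrier_vec 2 - {0\<^sub>v 2} \<Longrightarrow>
      card {j. j < n \<and> col_point 2 G j = v} \<in> {a, a + 1}"
  shows "twofi_optimal 2 q n G"
proof -
  have dim: "dim_row G = 2 + q" "dim_col G = n" using gen by (auto simp: array_generator_def)
  have nz_row: "row_point 2 G j \<noteq> 0\<^sub>v (2 + q - 2)" if "j < n" for j
    using nz(2)[OF that] by simp
  note props = unconfounded_pairs_if_null_sets_large[of G 2, unfolded dim, OF large nz(1) nz_row]
  have col: "col_point 2 G ` {..<n} \<subseteq> carrier_vec 2 - {0\<^sub>v 2}"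
    using nz(1) by (intro image_subsetI DiffI carrier_vecI) simp_all
  have "equal_pairs (row_point 2 G) n = {}"
    using inj by (auto simp: equal_pairs_def pairs_within_def inj_on_def)
  then have card_G: "card (unconfounded_pairs 2 G) =
      card (pairs_within {..<n}) - card (equal_pairs (col_point 2 G) n)"
    using props(2) by (simp add: card_Diff_subset equal_pairs_subset)
  have "card (unconfounded_pairs 2 H) \<le> card (unconfounded_pairs 2 G)"
    if H: "array_generator 2 q n H" "main_effects_unconfounded 2 H" for H :: "bit mat"
  proof -
    have dim_H: "dim_col H = n" using H by (auto simp: array_generator_def)
    have "card (unconfounded_pairs 2 H) \<le>
        card (pairs_within {..<n} - equal_pairs (col_point 2 H) n)"
      by (rule card_mono) (use unconfounded_pairs_subset[OF H(2)] dim_H in auto)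
    also have "\<dots> = card (pairs_within {..<n}) - card (equal_pairs (col_point 2 H) n)"
      by (simp add: card_Diff_subset equal_pairs_subset)
    also have "card (equal_pairs (col_point 2 G) n) \<le> card (equal_pairs (col_point 2 H) n)"
      using card_equal_pairs_ge(1)[OF finite_nonzero_vecs_2, of "col_point 2 H" n a]
        points_in_nonzero_vectors(1)[OF H(2)] dim_H
        card_equal_pairs_ge(2)[OF finite_nonzero_vecs_2 col balanced]
      by simp
    then have "card (pairs_within {..<n}) - card (equal_pairs (col_point 2 H) n) \<le>
        card (unconfounded_pairs 2 G)"
      unfolding card_G by simp
    finally show ?thesis .
  qed
  then show ?thesis
    unfolding twofi_optimal_def num_unconfounded_2fis_eq using gen props(1) by blast
qed

section \<open>The bordered generator\<close>

lemma dim_append_cols [simp]: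
  "dim_row (A @\<^sub>c B) = dim_row A" "dim_col (A @\<^sub>c B) = dim_col A + dim_col B"
  by (simp_all add: append_cols_def)

lemma index_append_cols:
  assumes "dim_row A = dim_row B" "i < dim_row A" "j < dim_col A + dim_col B"
  shows "(A @\<^sub>c B) $$ (i, j) = (if j < dim_col A then A $$ (i, j) else B $$ (i, j - dim_col A))"
  using assms by (auto simp: append_cols_def)

lemma dim_append_rows [simp]:
  "dim_row (A @\<^sub>r B) = dim_row A + dim_row B" "dim_col (A @\<^sub>r B) = dim_col A"
  by (simp_all add: append_rows_def)

lemma index_append_rows:
  assumes "dim_col A = dim_col B" "i < dim_row A + dim_row B" "j < dim_col A"
  shows "(A @\<^sub>r B) $$ (i, j) = (if i < dim_row A then A $$ (i, j) else B $$ (i - dim_row A, j))"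
  using assms by (auto simp: append_rows_def)

text \<open>
  The common shape of the generators for \<open>q \<ge> 3\<close>.  The core \<open>(I F; E I+EF)\<close> is an invertible
  5 by 5 matrix; each of the \<open>k = q - 3\<close> additional rows comes with one additional column.
\<close>
definition bordered_generator :: "nat \<Rightarrow> bit mat \<Rightarrow> bit mat \<Rightarrow> bit mat" where
  "bordered_generator k z X =
     (1\<^sub>m 2 @\<^sub>c F_mat @\<^sub>c ones_col 2 @\<^sub>c X) @\<^sub>r
     (E_mat @\<^sub>c (1\<^sub>m 3 + E_mat * F_mat) @\<^sub>c z @\<^sub>c 0\<^sub>m 3 k) @\<^sub>r
     (0\<^sub>m k 2 @\<^sub>c 0\<^sub>m k 3 @\<^sub>c ones_col k @\<^sub>c 1\<^sub>m k)"

lemma dim_EF [simp]: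
  "dim_row E_mat = 3" "dim_col E_mat = 2" "dim_row F_mat = 2" "dim_col F_mat = 3"
  "dim_row (ones_col m) = m" "dim_col (ones_col m) = 1"
  by (simp_all add: E_mat_def F_mat_def mat_of_rows_list_def ones_col_def)

lemma I_plus_EF: "1\<^sub>m 3 + E_mat * F_mat = mat_of_rows_list 3 [[0, 0, 1], [1, 0, 0], [0, 1, 0]]"
  (is "?L = ?R")
proof (rule eq_matI)
  fix i j assume "i < dim_row ?R" "j < dim_col ?R"
  then have "i = 0 \<or> i = 1 \<or> i = 2" "j = 0 \<or> j = 1 \<or> j = 2"
    by (auto simp: mat_of_rows_list_def)
  then show "?L $$ (i, j) = ?R $$ (i, j)"
    by (elim disjE) (simp_all add: E_mat_def F_mat_def mat_of_rows_list_def scalar_prod_def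
      numeral_2_eq_2)
qed (simp_all add: mat_of_rows_list_def)

text \<open>
  A nonzero \<open>z\<close> keeps column 5 of the lower part from vanishing when \<open>k = 0\<close> and from repeating
  the border column when \<open>k = 1\<close>.
\<close>
locale bordered =
  fixes k :: nat and z X :: "bit mat"
  assumes z: "z \<in> carrier_mat 3 1" and z_nonzero: "\<exists>r<3. z $$ (r, 0) = 1"
    and X: "X \<in> carrier_mat 2 k"
begin

abbreviation G :: "bit mat" where
  "G \<equiv> bordered_generator k z X"

lemma dim_G [simp]: "dim_row G = 5 + k" "dim_col G = 6 + k"
  using z X by (auto simp: bordered_generator_def)

lemma top_block: "column_part 2 G = 1\<^sub>m 2 @\<^sub>c F_mat @\<^sub>c ones_col 2 @\<^sub>c X"
  by (rule eq_matI) (use z X in \<open>auto simp: column_part_def bordered_generator_def index_append_rows\<close>)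

lemma core_entries:
  assumes "j < 6"
  shows "G $$ (0, j) = [1, 0, 1, 0, 1, 1] ! j" "G $$ (1, j) = [0, 1, 1, 1, 0, 1] ! j"
    "G $$ (2, j) = [1, 0, 0, 0, 1, z $$ (0, 0)] ! j"
    "G $$ (3, j) = [0, 1, 1, 0, 0, z $$ (1, 0)] ! j"
    "G $$ (4, j) = [1, 1, 0, 1, 0, z $$ (2, 0)] ! j"
    "t < k \<Longrightarrow> G $$ (5 + t, j) = of_bool (j = 5)"
proof -
  have j: "j = 0 \<or> j = 1 \<or> j = 2 \<or> j = 3 \<or> j = 4 \<or> j = 5" using assms by auto
  note defs = index_append_rows index_append_cols
    E_mat_def F_mat_def mat_of_rows_list_def ones_col_def
  show "G $$ (0, j) = [1, 0, 1, 0, 1, 1] ! j"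
    unfolding bordered_generator_def I_plus_EF
    using j z X by (elim disjE) (simp_all add: defs)
  show "G $$ (1, j) = [0, 1, 1, 1, 0, 1] ! j"
    unfolding bordered_generator_def I_plus_EF
    using j z X by (elim disjE) (simp_all add: defs)
  show "G $$ (2, j) = [1, 0, 0, 0, 1, z $$ (0, 0)] ! j"
    unfolding bordered_generator_def I_plus_EF
    using j z X by (elim disjE) (simp_all add: defs)
  show "G $$ (3, j) = [0, 1, 1, 0, 0, z $$ (1, 0)] ! j"
    unfolding bordered_generator_def I_plus_EF
    using j z X by (elim disjE) (simp_all add: defs)
  show "G $$ (4, j) = [1, 1, 0, 1, 0, z $$ (2, 0)] ! j"
    unfolding bordered_generator_def I_plus_EF
    using j z X by (elim disjE) (simp_all add: defs)
  show "G $$ (5 + t, j) = of_bool (j = 5)" if "t < k"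
    unfolding bordered_generator_def I_plus_EF
    using j z X that by (elim disjE) (simp_all add: defs)
qed

lemma entries_column_5:
  assumes "r < 3"
  shows "G $$ (2 + r, 5) = z $$ (r, 0)"
proof -
  have "G $$ (2 + 0, 5) = z $$ (0, 0)" "G $$ (2 + 1, 5) = z $$ (1, 0)" "G $$ (2 + 2, 5) = z $$ (2, 0)"
    by (simp_all add: core_entries)
  moreover have "r = 0 \<or> r = 1 \<or> r = 2" using assms by auto
  ultimately show ?thesis by blast
qed

lemma border_entries:
  assumes "t < k"
  shows "r < 2 \<Longrightarrow> G $$ (r, 6 + t) = X $$ (r, t)"
    "r < 3 \<Longrightarrow> G $$ (2 + r, 6 + t) = 0"
    "r < k \<Longrightarrow> G $$ (5 + r, 6 + t) = of_bool (r = t)"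
  using z X assms by (auto simp: bordered_generator_def index_append_rows index_append_cols I_plus_EF mat_of_rows_list_def)

lemma sum_columns:
  fixes f :: "nat \<Rightarrow> bit"
  assumes "S \<subseteq> {..<6 + k}"
  shows "sum f S = (let x = \<lambda>j. of_bool (j \<in> S) in
    x 0 * f 0 + x 1 * f 1 + x 2 * f 2 + x 3 * f 3 + x 4 * f 4 + x 5 * f 5 + (\<Sum>t<k. x (6 + t) * f (6 + t)))"
proof -
  have "sum f S = (\<Sum>j<6 + k. of_bool (j \<in> S) * f j)"
    by (rule sum.mono_neutral_cong_left) (use assms in auto)
  moreover have "sum g {..<6 + k} = g 0 + g 1 + g 2 + g 3 + g 4 + g 5 + (\<Sum>t<k. g (6 + t))"
    for g :: "nat \<Rightarrow> bit"
  proof (induction k)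
    case 0
    show ?case by (simp add: eval_nat_numeral)
  next
    case (Suc k)
    then show ?case by (simp only: add_Suc_right sum.lessThan_Suc add.assoc)
  qed
  ultimately show ?thesis by (simp add: Let_def)
qed

lemma column_cases:
  assumes "j < 6 + k"
  obtains "j < 6" | t where "j = 6 + t" "t < k"
  using assms by (metis add_less_cancel_left le_add_diff_inverse linorder_not_less)

text \<open>
  The last \<open>k\<close> rows say that column 5 and the \<open>k\<close> border columns are taken together.  If they are not
  taken, the invertible core leaves the empty set only.  If they are, the core determines the
  remaining five indices.
\<close>
lemma null_set_solution:
  assumes S: "S \<subseteq> {..<6 + k}" "null_set G S"
  defines "x \<equiv> \<lambda>j. of_bool (j \<in> S) :: bit"
  shows "5 \<in> S" "\<And>t. t < k \<Longrightarrow> 6 + t \<in> S"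
    "x 0 = (\<Sum>t<k. X $$ (0, t)) + (\<Sum>t<k. X $$ (1, t)) + z $$ (0, 0) + z $$ (2, 0)"
    "x 1 = 1 + (\<Sum>t<k. X $$ (0, t)) + z $$ (0, 0) + z $$ (1, 0)"
    "x 2 = 1 + (\<Sum>t<k. X $$ (0, t)) + z $$ (0, 0)"
    "x 3 = 1 + (\<Sum>t<k. X $$ (1, t)) + z $$ (1, 0)"
    "x 4 = (\<Sum>t<k. X $$ (0, t)) + (\<Sum>t<k. X $$ (1, t)) + z $$ (2, 0)"
proof -
  have row: "x 0 * G $$ (r, 0) + x 1 * G $$ (r, 1) + x 2 * G $$ (r, 2) + x 3 * G $$ (r, 3)
      + x 4 * G $$ (r, 4) + x 5 * G $$ (r, 5) + (\<Sum>t<k. x (6 + t) * G $$ (r, 6 + t)) = 0"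
    if "r < 5 + k" for r
    using S that by (simp add: null_set_def sum_columns[OF S(1)] x_def Let_def)
  have border: "x (6 + t) = x 5" if "t < k" for t
  proof -
    have "(\<Sum>s<k. x (6 + s) * G $$ (5 + t, 6 + s)) = (\<Sum>s<k. if s = t then x (6 + t) else 0)"
      by (rule sum.cong) (use border_entries that in auto)
    also have "\<dots> = x (6 + t)" using that by simp
    finally show ?thesis
      using row[of "5 + t"] that by (subst bit_eq_iff_one) (simp add: core_entries bit_add_eq_0_iff)
  qed
  have rows: "x 0 + x 2 + x 4 + x 5 + x 5 * (\<Sum>t<k. X $$ (0, t)) = 0"
    "x 1 + x 2 + x 3 + x 5 + x 5 * (\<Sum>t<k. X $$ (1, t)) = 0"
    "x 0 + x 4 + x 5 * z $$ (0, 0) = 0"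
    "x 1 + x 2 + x 5 * z $$ (1, 0) = 0"
    "x 0 + x 1 + x 3 + x 5 * z $$ (2, 0) = 0"
  proof -
    have "(\<Sum>t<k. x (6 + t) * G $$ (r, 6 + t)) = x 5 * (\<Sum>t<k. X $$ (r, t))" if "r < 2" for r
      unfolding sum_distrib_left by (rule sum.cong) (use border border_entries(1) that in auto)
    from this[of 0] this[of 1]
    show "x 0 + x 2 + x 4 + x 5 + x 5 * (\<Sum>t<k. X $$ (0, t)) = 0"
      "x 1 + x 2 + x 3 + x 5 + x 5 * (\<Sum>t<k. X $$ (1, t)) = 0"
      using row[of 0] row[of 1]
      by (simp_all add: core_entries core_entries(2)[unfolded One_nat_def])
    have "(\<Sum>t<k. x (6 + t) * G $$ (2 + r, 6 + t)) = 0" if "r < 3" for r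
      by (rule sum.neutral) (use border_entries(2) that in auto)
    from this[of 0] this[of 1] this[of 2]
    show "x 0 + x 4 + x 5 * z $$ (0, 0) = 0"
      "x 1 + x 2 + x 5 * z $$ (1, 0) = 0"
      "x 0 + x 1 + x 3 + x 5 * z $$ (2, 0) = 0"
      using row[of 2] row[of 3] row[of 4] by (simp_all add: core_entries)
  qed
  have five: "x 5 = 1"
  proof (rule ccontr)
    assume "x 5 \<noteq> 1"
    then have "x 5 = 0" by simp
    then have core: "x 0 = 0 \<and> x 1 = 0 \<and> x 2 = 0 \<and> x 3 = 0 \<and> x 4 = 0"
      using rows by (cases "x 0"; cases "x 1"; cases "x 2"; cases "x 3"; cases "x 4"; simp)
    then have "x j = 0" if "j < 6 + k" for j
    proof -
      show ?thesis using that
      proof (cases rule: column_cases)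
        case 1
        then have "j = 0 \<or> j = 1 \<or> j = 2 \<or> j = 3 \<or> j = 4 \<or> j = 5" by auto
        then show ?thesis using core \<open>x 5 = 0\<close> by auto
      next
        case (2 t)
        then show ?thesis using border \<open>x 5 = 0\<close> by simp
      qed
    qed
    then have "S = {}" using S(1) by (auto simp: x_def)
    then show False using S(2) by (simp add: null_set_def)
  qed
  then show "5 \<in> S" by (simp add: x_def split: if_splits)
  show "6 + t \<in> S" if "t < k" for t
    using border[OF that] five by (simp add: x_def split: if_splits)
  have "a = u + v + z0 + z2 \<and> b = 1 + u + z0 + z1 \<and> c = 1 + u + z0 \<and> d = 1 + v + z1 \<and> e = u + v + z2"
    if "a + c + e + 1 + u = 0" "b + c + d + 1 + v = 0" "a + e + z0 = 0" "b + c + z1 = 0" "a + b + d + z2 = 0"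
    for a b c d e u v z0 z1 z2 :: bit
    using that by (cases a; cases b; cases c; cases d; cases e; simp)
  from this[OF rows[unfolded five mult_1]] show
    "x 0 = (\<Sum>t<k. X $$ (0, t)) + (\<Sum>t<k. X $$ (1, t)) + z $$ (0, 0) + z $$ (2, 0)"
    "x 1 = 1 + (\<Sum>t<k. X $$ (0, t)) + z $$ (0, 0) + z $$ (1, 0)"
    "x 2 = 1 + (\<Sum>t<k. X $$ (0, t)) + z $$ (0, 0)"
    "x 3 = 1 + (\<Sum>t<k. X $$ (1, t)) + z $$ (1, 0)"
    "x 4 = (\<Sum>t<k. X $$ (0, t)) + (\<Sum>t<k. X $$ (1, t)) + z $$ (2, 0)"
    by blast+
qed

text \<open>By the preceding lemma, column 5 belongs to every null set.\<close>
lemma array_generator: "array_generator 2 (3 + k) (6 + k) G" "\<exists>d. yields_design 2 (3 + k) (6 + k) G d"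
proof -
  have "G \<in> carrier_mat (2 + (3 + k)) (6 + k)" by (intro carrier_matI) auto
  note * = array_generator_if_common_element[OF this, of 5]
  show "array_generator 2 (3 + k) (6 + k) G" "\<exists>d. yields_design 2 (3 + k) (6 + k) G d"
    using null_set_solution(1) by (auto intro: *)
qed

lemma col_point_core: "j < 6 \<Longrightarrow> col_point 2 G j = vec2 ([1, 0, 1, 0, 1, 1] ! j) ([0, 1, 1, 1, 0, 1] ! j)"
  by (rule vec2_eqI) (simp_all add: column_part_def core_entries flip: One_nat_def)

lemma col_point_border: "t < k \<Longrightarrow> col_point 2 G (6 + t) = col X t"
  using X by (intro eq_vecI) (auto simp: column_part_def border_entries(1))

lemma row_point_index: "r < 3 + k \<Longrightarrow> j < 6 + k \<Longrightarrow> row_point 2 G j $ r = G $$ (2 + r, j)"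
  by (simp add: row_part_def)

text \<open>Each point occurs exactly twice among the first six columns of the upper part.\<close>
lemma card_col_point_fibre:
  assumes "v \<in> carrier_vec 2 - {0\<^sub>v 2}"
  shows "card {j. j < 6 + k \<and> col_point 2 G j = v} = 2 + card {t. t < k \<and> col X t = v}"
proof -
  let ?core = "{j. j < 6 \<and> col_point 2 G j = v}"
  let ?border = "{t. t < k \<and> col X t = v}"
  have "{j. j < 6 + k \<and> col_point 2 G j = v} = ?core \<union> (+) 6 ` ?border"
    by (auto elim!: column_cases simp: col_point_border)
  also have "card \<dots> = card ?core + card ((+) 6 ` ?border)"
    by (rule card_Un_disjoint) auto
  also have "card ((+) 6 ` ?border) = card ?border"
    by (rule card_image) simp
  also have "?core = set (filter (\<lambda>j. vec2 ([1, 0, 1, 0, 1, 1] ! j) ([0, 1, 1, 1, 0, 1] ! j) = v) [0..<6])"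
    by (auto simp: col_point_core)
  also have "card \<dots> = 2"
    using assms unfolding nonzero_vecs_2 by (auto simp: upt_rec)
  finally show ?thesis .
qed

lemma row_point_nonzero:
  assumes "j < 6 + k"
  shows "row_point 2 G j \<noteq> 0\<^sub>v (3 + k)"
proof -
  have "\<exists>r<3 + k. G $$ (2 + r, j) = 1"
    using assms
  proof (cases rule: column_cases)
    case 1
    then have "j = 0 \<or> j = 1 \<or> j = 2 \<or> j = 3 \<or> j = 4 \<or> j = 5" by auto
    moreover have "\<exists>r<3. G $$ (2 + r, 5) = 1"
      using z_nonzero entries_column_5 by metis
    moreover have "G $$ (2 + 0, 0) = 1" "G $$ (2 + 1, 1) = 1" "G $$ (2 + 1, 2) = 1"
      "G $$ (2 + 2, 3) = 1" "G $$ (2 + 0, 4) = 1"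
      by (simp_all add: core_entries)
    moreover have "r < 3 \<Longrightarrow> r < 3 + k" "0 < 3 + k" "1 < 3 + k" "2 < 3 + k" for r by auto
    ultimately show ?thesis by blast
  next
    case (2 t)
    then have "G $$ (2 + (3 + t), j) = 1" using border_entries(3)[of t t] by simp
    then show ?thesis using 2 by (intro exI[of _ "3 + t"]) auto
  qed
  then obtain r where "r < 3 + k" "G $$ (2 + r, j) = 1" by blast
  then have "row_point 2 G j $ r = 1" using row_point_index assms by metis
  then show ?thesis using \<open>r < 3 + k\<close> by (metis index_zero_vec(1) zero_neq_one)
qed

lemma row_point_eq_entries:
  assumes "row_point 2 G i = row_point 2 G j" "i < 6 + k" "j < 6 + k" "r < 3 + k"
  shows "G $$ (2 + r, i) = G $$ (2 + r, j)"
  using assms row_point_index by metis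

text \<open>
  With at least one border row all lower columns are distinct.  Without one, column 5 may repeat a
  core column, as happens for \<open>q = 3\<close>.
\<close>
lemma row_point_eqD:
  assumes "row_point 2 G i = row_point 2 G j" "i < j" "j < 6 + k"
  shows "k = 0" "i < 5" "j = 5"
proof -
  have eq: "G $$ (2 + r, i) = G $$ (2 + r, j)" if "r < 3 + k" for r
    by (rule row_point_eq_entries) (use assms that in auto)
  have "j < 6"
  proof (rule ccontr)
    assume "\<not> j < 6"
    then obtain t where t: "j = 6 + t" "t < k" using assms(3) by (auto elim: column_cases)
    then have one: "G $$ (5 + t, i) = 1"
      using eq[of "3 + t"] border_entries(3)[of t t] by simp
    have "i < 6 + k" using assms by simp
    then have "i = 5"
    proof (cases rule: column_cases)
      case 1
      then show ?thesis using one core_entries(6)[OF 1 \<open>t < k\<close>] by (simp split: if_splits)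
    next
      case (2 s)
      then show ?thesis using one border_entries(3)[of s t] t assms(2) by simp
    qed
    obtain r where r: "r < 3" "z $$ (r, 0) = 1" using z_nonzero by blast
    then have "G $$ (2 + r, 5) = 1" by (simp only: entries_column_5)
    then show False
      using eq[of r] r t border_entries(2)[of t r] \<open>i = 5\<close> by simp
  qed
  have "i < 6" using \<open>j < 6\<close> assms(2) by simp
  have "\<not> j < 5"
  proof
    assume "j < 5"
    then have ij: "j = 1 \<or> j = 2 \<or> j = 3 \<or> j = 4" "i = 0 \<or> i = 1 \<or> i = 2 \<or> i = 3"
      using assms(2) by auto
    show False
      using eq[of 0] eq[of 1] eq[of 2] ij assms(2) by (auto simp: core_entries)
  qed
  then show "j = 5" "i < 5" using \<open>j < 6\<close> assms(2) by auto
  show "k = 0"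
  proof (rule ccontr)
    assume "k \<noteq> 0"
    then show False
      using eq[of 3] core_entries(6)[OF \<open>i < 6\<close>, of 0] core_entries(6)[OF \<open>j < 6\<close>, of 0]
        \<open>j = 5\<close> \<open>i < 5\<close> by simp
  qed
qed

end

section \<open>Optimality of the given generators\<close>

text \<open>Over GF(2) a point contains a single nonzero vector.\<close>
lemma appearances_eq_card_fibre:
  fixes A :: "bit mat"
  assumes v: "v \<in> carrier_vec 2 - {0\<^sub>v 2}" and A: "dim_row A = 2"
  shows "appearances (point_of v) A = card {j. j < dim_col A \<and> col A j = v}"
proof -
  have point: "point_of w = {0\<^sub>v 2, w}" if "w \<in> carrier_vec 2" for w :: "bit vec"
  proof -
    have "point_of w = (\<lambda>a. a \<cdot>\<^sub>v w) ` {0, 1}"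
      unfolding point_of_def using UNIV_bit by (rule arg_cong)
    then have "point_of w = {0 \<cdot>\<^sub>v w, 1 \<cdot>\<^sub>v w}" by blast
    moreover have "0 \<cdot>\<^sub>v w = 0\<^sub>v 2" "1 \<cdot>\<^sub>v w = w"
      using that by (auto intro: eq_vecI)
    ultimately show ?thesis by simp
  qed
  have "col A j \<noteq> 0\<^sub>v 2 \<and> point_of (col A j) = point_of v \<longleftrightarrow> col A j = v" if "j < dim_col A" for j
  proof -
    have "col A j \<in> carrier_vec 2" using A by (intro carrier_vecI) simp
    then show ?thesis using v by (auto simp: point doubleton_eq_iff)
  qed
  then show ?thesis
    unfolding appearances_def A by (intro arg_cong[of _ _ card]) auto
qed

context bordered
begin

lemma appearances_top_block:
  assumes "v \<in> carrier_vec 2 - {0\<^sub>v 2}"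
  shows "appearances (point_of v) (1\<^sub>m 2 @\<^sub>c F_mat @\<^sub>c ones_col 2 @\<^sub>c X)
    = 2 + card {t. t < k \<and> col X t = v}"
  unfolding top_block[symmetric]
  using appearances_eq_card_fibre[OF assms, of "column_part 2 G"] card_col_point_fibre[OF assms]
  by simp

text \<open>
  Since \<open>z\<close> is 1 in its first two entries, exactly one of the columns 0 and 4 and exactly one of the
  columns 1 and 2 is in the null set.  Column 5 and two border columns make five.
\<close>
lemma null_sets_large_if_core_ones:
  assumes "z $$ (0, 0) = 1" "z $$ (1, 0) = 1" "2 \<le> k" "S \<subseteq> {..<6 + k}" "null_set G S"
  shows "5 \<le> card S"
proof -
  note eqs = null_set_solution[OF assms(4,5)]
  obtain i where i: "i \<in> S" "i = 0 \<or> i = 4"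
  proof (cases "4 \<in> S")
    case False
    then have "0 \<in> S" using eqs(3,7) assms(1) by (auto split: if_splits)
    then show ?thesis using that by blast
  qed (use that in blast)
  obtain j where j: "j \<in> S" "j = 1 \<or> j = 2"
  proof (cases "2 \<in> S")
    case False
    then have "1 \<in> S" using eqs(4,5) assms(2) by (auto split: if_splits)
    then show ?thesis using that by blast
  qed (use that in blast)
  have "{i, j, 5, 6 + 0, 6 + 1} \<subseteq> S"
    using i j eqs(1) eqs(2)[of 0] eqs(2)[of 1] \<open>2 \<le> k\<close> by auto
  moreover have "card {i, j, 5, 6 + 0, 6 + 1 :: nat} = 5" using i j by auto
  moreover have "finite S" using assms(4) finite_subset by blast
  ultimately show ?thesis by (metis card_mono)
qed

lemma col_point_nonzero:
  assumes "j < 6 + k" and "\<And>t. t < k \<Longrightarrow> col X t \<noteq> 0\<^sub>v 2"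
  shows "col_point 2 G j \<noteq> 0\<^sub>v 2"
  using assms(1)
proof (cases rule: column_cases)
  case 1
  then have "j = 0 \<or> j = 1 \<or> j = 2 \<or> j = 3 \<or> j = 4 \<or> j = 5" by auto
  then show ?thesis unfolding col_point_core[OF 1] zero_vec2 by auto
qed (use assms(2) in \<open>simp add: col_point_border\<close>)

lemma twofi_optimal:
  assumes large: "\<And>S. S \<subseteq> {..<6 + k} \<Longrightarrow> null_set G S \<Longrightarrow> 5 \<le> card S" and "0 < k"
    and nz: "\<And>t. t < k \<Longrightarrow> col X t \<noteq> 0\<^sub>v 2"
    and balanced: "\<And>v. v \<in> carrier_vec 2 - {0\<^sub>v 2} \<Longrightarrow> 2 + card {t. t < k \<and> col X t = v} \<in> {a, a + 1}"
  shows "twofi_optimal 2 (3 + k) (6 + k) G"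
proof (rule twofi_optimal_if_balanced)
  show "inj_on (row_point 2 G) {..<6 + k}"
    by (rule linorder_inj_onI') (use row_point_eqD(1) \<open>0 < k\<close> in auto)
  show "card {j. j < 6 + k \<and> col_point 2 G j = v} \<in> {a, a + 1}" if "v \<in> carrier_vec 2 - {0\<^sub>v 2}" for v
    unfolding card_col_point_fibre[OF that] by (rule balanced[OF that])
qed (use array_generator(1) large row_point_nonzero col_point_nonzero nz in auto)

end

lemma yields_twofi_optimal_fractionI:
  assumes "bordered k z X" "twofi_optimal 2 (3 + k) (6 + k) (bordered_generator k z X)"
  shows "yields_twofi_optimal_fraction 2 (3 + k) (6 + k) 1 (bordered_generator k z X)"
  unfolding yields_twofi_optimal_fraction_def
  using bordered.array_generator(2)[OF assms(1)] assms(2) by simp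

lemma card_ge_5_if_contains_5: assumes "A \<subseteq> S" "S \<subseteq> {..<n::nat}" "card A \<ge> 5" shows "5 \<le> card S"
  using assms by (meson card_mono finite_lessThan finite_subset le_trans)

text \<open>
  The only null set consists of all five columns.  With 0-based indices the upper colour classes are
  \<open>{1, 3, 4}, {0}, {2}\<close> and the lower ones \<open>{0, 2, 4}, {1}, {3}\<close>.
\<close>
lemma generator_a_optimal: "yields_twofi_optimal_fraction 2 2 5 1 generator_a"
proof -
  let ?G = generator_a
  have dim: "?G \<in> carrier_mat 4 5" "dim_row ?G = 4" "dim_col ?G = 5"
    by (auto simp: generator_a_def mat_of_rows_list_def intro: carrier_matI)
  have rows: "?G $$ (0, j) = [1, 1, 0, 1, 1] ! j" "?G $$ (1, j) = [0, 1, 1, 1, 1] ! j"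
    "?G $$ (2, j) = [1, 1, 1, 0, 1] ! j" "?G $$ (3, j) = [1, 0, 1, 1, 1] ! j" if "j < 5" for j
    using that by (simp_all add: generator_a_def mat_of_rows_list_def)
  have all: "S = {..<5}" if S: "S \<subseteq> {..<5}" "null_set ?G S" for S
  proof -
    define x where "x j = (of_bool (j \<in> S) :: bit)" for j
    have sum: "(\<Sum>j\<in>S. ?G $$ (r, j)) = (\<Sum>j<5. x j * ?G $$ (r, j))" for r
      unfolding x_def by (rule sum.mono_neutral_cong_left) (use S in auto)
    have row: "x 0 * ?G $$ (r, 0) + x 1 * ?G $$ (r, 1) + x 2 * ?G $$ (r, 2)
       + x 3 * ?G $$ (r, 3) + x 4 * ?G $$ (r, 4) = 0" if "r < 4" for r
    proof -
      have "(\<Sum>j<5. x j * ?G $$ (r, j)) = 0"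
        using S(2) that dim unfolding null_set_def sum by auto
      then show ?thesis by (simp add: eval_nat_numeral add.assoc)
    qed
    have eqs: "x 0 + x 1 + x 3 + x 4 = 0" "x 1 + x 2 + x 3 + x 4 = 0" "x 0 + x 1 + x 2 + x 4 = 0"
      "x 0 + x 2 + x 3 + x 4 = 0"
      using row[of 0] row[of 1] row[of 2] row[of 3]
      by (simp_all add: rows rows(2)[unfolded One_nat_def])
    have "x 0 = x 4 \<and> x 1 = x 4 \<and> x 2 = x 4 \<and> x 3 = x 4"
      using eqs by (cases "x 0"; cases "x 1"; cases "x 2"; cases "x 3"; cases "x 4"; simp)
    then have eq: "x j = x 4" if "j < 5" for j
    proof -
      have "j = 0 \<or> j = 1 \<or> j = 2 \<or> j = 3 \<or> j = 4" using that by auto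
      then show ?thesis using \<open>x 0 = x 4 \<and> _\<close> by blast
    qed
    obtain i where "i \<in> S" using S(2) by (auto simp: null_set_def)
    then have "x 4 = 1" using eq[of i] S(1) by (auto simp: x_def)
    then show ?thesis using eq S(1) by (force simp: x_def split: if_splits)
  qed
  have large: "5 \<le> card S" if "null_set ?G S" "S \<subseteq> {..<dim_col ?G}" for S
    using all[of S] that dim by simp
  have zero: "0 \<in> S" if "S \<subseteq> {..<5}" "null_set ?G S" for S
    using all[OF that] by simp
  have "?G \<in> carrier_mat (2 + 2) 5" using dim(1) by simp
  note * = array_generator_if_common_element[OF this _ _ _ _ zero]
  have gen: "array_generator 2 2 5 ?G" "\<exists>d. yields_design 2 2 5 ?G d"
    by (rule *; simp)+
  have points: "col_point 2 ?G j = vec2 ([1, 1, 0, 1, 1] ! j) ([0, 1, 1, 1, 1] ! j)"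
    "row_point 2 ?G j = vec2 ([1, 1, 1, 0, 1] ! j) ([1, 0, 1, 1, 1] ! j)" if "j < 5" for j
    by (rule vec2_eqI; use that dim in \<open>simp add: column_part_def row_part_def rows flip: One_nat_def\<close>)+
  have nz: "col_point 2 ?G j \<noteq> 0\<^sub>v 2 \<and> row_point 2 ?G j \<noteq> 0\<^sub>v 2" if "j < 5" for j
  proof -
    have "j = 0 \<or> j = 1 \<or> j = 2 \<or> j = 3 \<or> j = 4" using that by auto
    then show ?thesis unfolding points[OF that] zero_vec2 by auto
  qed
  have nz': "j < dim_col ?G \<Longrightarrow> col_point 2 ?G j \<noteq> 0\<^sub>v 2"
    "j < dim_col ?G \<Longrightarrow> row_point 2 ?G j \<noteq> 0\<^sub>v (dim_row ?G - 2)" for j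
    using nz dim by auto
  have main: "main_effects_unconfounded 2 ?G"
    by (rule unconfounded_pairs_if_null_sets_large(1)[OF large nz'])
  have "unconfounded_pairs 2 ?G = pairs_within {..<dim_col ?G} -
      (equal_pairs (col_point 2 ?G) (dim_col ?G) \<union> equal_pairs (row_point 2 ?G) (dim_col ?G))"
    by (rule unconfounded_pairs_if_null_sets_large(2)[OF large nz'])
  then have pairs: "unconfounded_pairs 2 ?G =
      pairs_within {..<5} - (equal_pairs (col_point 2 ?G) 5 \<union> equal_pairs (row_point 2 ?G) 5)"
    unfolding dim .
  \<comment> \<open>The four pairs contained in neither of the two colour classes of size 3.\<close>
  have "{(0, 1), (0, 3), (1, 2), (2, 3)} \<subseteq> unconfounded_pairs 2 ?G"
    unfolding pairs by (auto simp: pairs_within_def equal_pairs_def points)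
  then have "card {(0::nat, 1::nat), (0, 3), (1, 2), (2, 3)} \<le> card (unconfounded_pairs 2 ?G)"
    by (rule card_mono[rotated]) (simp add: pairs)
  then have four: "4 \<le> card (unconfounded_pairs 2 ?G)" by simp
  have "card (unconfounded_pairs 2 H) \<le> card (unconfounded_pairs 2 ?G)"
    if "array_generator 2 2 5 H" "main_effects_unconfounded 2 H" for H :: "bit mat"
    using card_unconfounded_pairs_2_by_2[of H] that four by (auto simp: array_generator_def)
  then show ?thesis
    unfolding yields_twofi_optimal_fraction_def twofi_optimal_def num_unconfounded_2fis_eq
    using gen main by auto
qed

lemma append_cols_0: "dim_row A = r \<Longrightarrow> A @\<^sub>c 0\<^sub>m r 0 = A"
  by (rule eq_matI) (auto simp: index_append_cols)

lemma append_rows_0: "dim_col A = c \<Longrightarrow> dim_row B = 0 \<Longrightarrow> dim_col B = c \<Longrightarrow> A @\<^sub>r B = A"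
  by (rule eq_matI) (auto simp: index_append_rows)

lemma generator_b_eq: "generator_b = bordered_generator 0 (e_col 3 3) (0\<^sub>m 2 0)"
  by (simp add: generator_b_def bordered_generator_def append_cols_0 append_rows_0 e_col_def)

lemma generator_c_eq: "generator_c = bordered_generator 1 (e_col 3 1) (e_col 2 1)"
proof -
  have "1\<^sub>m 1 = (ones_col 1 :: bit mat)" by (rule eq_matI) (auto simp: ones_col_def)
  then show ?thesis by (simp add: generator_c_def bordered_generator_def)
qed

text \<open>
  The upper colouring is balanced (three equally coloured pairs); in the lower part exactly the
  columns 3 and 5 coincide.  Eleven pairs remain.
\<close>
lemma generator_b_optimal: "yields_twofi_optimal_fraction 2 3 6 1 generator_b"
proof -
  define X :: "bit mat" where "X = 0\<^sub>m 2 0"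
  define z :: "bit mat" where "z = e_col 3 3"
  interpret bordered 0 z X
    by unfold_locales (auto simp: X_def z_def e_col_def intro: exI[of _ 2])
  let ?G = "bordered_generator 0 z X"
  have zs: "z $$ (0, 0) = 0" "z $$ (1, 0) = 0" "z $$ (2, 0) = 1"
    by (simp_all add: z_def e_col_def)
  have large: "5 \<le> card S" if "null_set ?G S" "S \<subseteq> {..<dim_col ?G}" for S
  proof -
    have "S \<subseteq> {..<6 + 0}" using that by simp
    note eqs = null_set_solution[OF this that(1)]
    have "{1, 2, 3, 4, 5} \<subseteq> S"
      using eqs(1,4-7) zs by (simp split: if_splits)
    then show ?thesis by (rule card_ge_5_if_contains_5[OF _ that(2)]) simp
  qed
  have nz': "j < dim_col ?G \<Longrightarrow> col_point 2 ?G j \<noteq> 0\<^sub>v 2"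
    "j < dim_col ?G \<Longrightarrow> row_point 2 ?G j \<noteq> 0\<^sub>v (dim_row ?G - 2)" for j
    using col_point_nonzero[of j] row_point_nonzero[of j] by auto
  note props = unconfounded_pairs_if_null_sets_large[OF large nz']
  have dim: "dim_col ?G = 6" by simp
  have "col_point 2 ?G ` {..<6} \<subseteq> carrier_vec 2 - {0\<^sub>v 2}"
    using nz'(1) dim by (intro image_subsetI DiffI carrier_vecI) simp_all
  then have "2 * 2 * 6 = 2 * card (equal_pairs (col_point 2 ?G) 6) + 3 * 2 * (2 + 1)"
    using card_equal_pairs_ge(2)[OF finite_nonzero_vecs_2, of "col_point 2 ?G" 6 2]
      card_col_point_fibre dim
    by (simp add: card_nonzero_vecs_2)
  moreover have "equal_pairs (row_point 2 ?G) 6 \<subseteq> {(3, 5)}"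
  proof -
    have "i = 3 \<and> j = 5" if "i < j" "j < 6" "row_point 2 ?G i = row_point 2 ?G j" for i j
    proof -
      have "i < 5" "j = 5" using row_point_eqD[OF that(3,1)] that(2) by auto
      have eq: "?G $$ (2 + r, i) = z $$ (r, 0)" if "r < 3" for r
        using row_point_eq_entries[of i 5 r] entries_column_5[OF that] that
          \<open>row_point 2 ?G i = row_point 2 ?G j\<close> \<open>i < 5\<close> \<open>j = 5\<close> by simp
      have "?G $$ (2, i) = 0" "?G $$ (3, i) = 0"
        using eq[of 0] eq[of 1] zs by simp_all
      moreover have "i = 0 \<or> i = 1 \<or> i = 2 \<or> i = 3 \<or> i = 4" using \<open>i < 5\<close> by auto
      ultimately have "i = 3" by (elim disjE) (simp_all add: core_entries)
      then show ?thesis using \<open>j = 5\<close> by simp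
    qed
    then show ?thesis by (auto simp: equal_pairs_def pairs_within_def)
  qed
  then have "card (equal_pairs (row_point 2 ?G) 6) \<le> 1"
    using card_mono[of "{(3::nat, 5::nat)}" "equal_pairs (row_point 2 ?G) 6"] by simp
  moreover have "card (pairs_within {..<6}) = 15"
    using card_pairs_within[of "{..<6}"] by simp
  moreover have "card (pairs_within {..<6}) \<le> card (unconfounded_pairs 2 ?G \<union>
      (equal_pairs (col_point 2 ?G) 6 \<union> equal_pairs (row_point 2 ?G) 6))"
    by (rule card_mono) (use props(2) dim in auto)
  moreover have "\<dots> \<le> card (unconfounded_pairs 2 ?G) +
      (card (equal_pairs (col_point 2 ?G) 6) + card (equal_pairs (row_point 2 ?G) 6))"
    by (meson add_left_mono card_Un_le order_trans)
  ultimately have eleven: "11 \<le> card (unconfounded_pairs 2 ?G)"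
    by (simp, linarith?)
  have "card (unconfounded_pairs 2 H) \<le> card (unconfounded_pairs 2 ?G)"
    if "array_generator 2 3 6 H" "main_effects_unconfounded 2 H" for H :: "bit mat"
    using card_unconfounded_pairs_2_by_3[of H] that eleven by (auto simp: array_generator_def)
  then have "twofi_optimal 2 3 6 ?G"
    unfolding twofi_optimal_def num_unconfounded_2fis_eq
    using array_generator(1) props(1) by auto
  then show ?thesis
    using yields_twofi_optimal_fractionI[of 0 z X] bordered_axioms
    by (simp add: generator_b_eq X_def z_def)
qed

lemma generator_c_optimal: "yields_twofi_optimal_fraction 2 4 7 1 generator_c"
proof -
  define X :: "bit mat" where "X = e_col 2 1"
  define z :: "bit mat" where "z = e_col 3 1"
  interpret bordered 1 z X
    by unfold_locales (auto simp: X_def z_def e_col_def intro: exI[of _ 0])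
  let ?G = "bordered_generator 1 z X"
  have entries: "z $$ (0, 0) = 1" "z $$ (1, 0) = 0" "z $$ (2, 0) = 0" "X $$ (0, 0) = 1" "X $$ (1, 0) = 0"
    by (simp_all add: z_def X_def e_col_def)
  have "twofi_optimal 2 (3 + 1) (6 + 1) ?G"
  proof (rule twofi_optimal[where a = 2])
    fix S assume S: "S \<subseteq> {..<6 + 1}" "null_set ?G S"
    note eqs = null_set_solution[OF S]
    have "{1, 2, 3, 4, 5} \<subseteq> S"
      using eqs(1,4-7) entries by (simp split: if_splits)
    then show "5 \<le> card S" by (rule card_ge_5_if_contains_5[OF _ S(1)]) simp
  next
    fix t :: nat assume "t < 1"
    have "col X 0 $ 0 = 1" using entries(4) X by simp
    then show "col X t \<noteq> 0\<^sub>v 2" using \<open>t < 1\<close> by auto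
  next
    fix v :: "bit vec"
    have "card {t. t < 1 \<and> col X t = v} \<le> card {0 :: nat}" by (rule card_mono) auto
    moreover have "2 + m \<in> {2, 2 + 1}" if "m \<le> card {0 :: nat}" for m :: nat
      using that by auto
    ultimately show "2 + card {t. t < 1 \<and> col X t = v} \<in> {2, 2 + 1}" by blast
  qed simp
  then show ?thesis
    using yields_twofi_optimal_fractionI[of 1 z X] bordered_axioms
    by (simp add: generator_c_eq X_def z_def)
qed

lemma card_residue_class:
  assumes "r < 3"
  shows "card {t. t < k \<and> t mod 3 = r} \<in> {k div 3, k div 3 + 1}"
proof -
  have "{t. t < k \<and> t mod 3 = r} = (\<lambda>i. 3 * i + r) ` {..<(k + 2 - r) div 3}"
  proof (intro equalityI subsetI)
    fix t assume t: "t \<in> {t. t < k \<and> t mod 3 = r}"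
    define m where "m = t div 3"
    have "t = 3 * m + r" using t unfolding m_def by auto
    then have "Suc m * 3 \<le> k + 2 - r" using t assms by simp
    then have "m < (k + 2 - r) div 3"
      by (simp only: less_eq_div_iff_mult_less_eq flip: Suc_le_eq)
    with \<open>t = 3 * m + r\<close> show "t \<in> (\<lambda>i. 3 * i + r) ` {..<(k + 2 - r) div 3}" by blast
  qed (use assms in auto)
  moreover have "card ((\<lambda>i. 3 * i + r) ` {..<(k + 2 - r) div 3}) = (k + 2 - r) div 3"
    by (subst card_image) (auto simp: inj_on_def)
  moreover have "(k + 2 - r) div 3 = k div 3 \<or> (k + 2 - r) div 3 = k div 3 + 1"
  proof -
    have "r = 0 \<or> r = 1 \<or> r = 2" using assms by auto
    then show ?thesis by (elim disjE; simp; presburger)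
  qed
  ultimately show ?thesis by simp
qed

lemma bordered_ones_col: "X \<in> carrier_mat 2 k \<Longrightarrow> bordered k (ones_col 3) X"
  by unfold_locales (auto simp: ones_col_def intro: exI[of _ 0])

lemma PG_points_2: "PG_points 2 = point_of ` (carrier_vec 2 - {0\<^sub>v 2})"
  by (simp add: PG_points_def)

text \<open>
  Cycling through the three points distributes the \<open>q - 3\<close> columns of \<open>X\<close> evenly, and the columns
  before \<open>X\<close> already contain each point twice.
\<close>
lemma ex_admissible_X:
  assumes "3 \<le> q"
  shows "\<exists>X. admissible_X q (q + 3) X"
proof -
  define k where "k = q - 3"
  define w where "w t = (if t mod 3 = 0 then vec2 1 0 else if t mod 3 = 1 then vec2 0 1 else vec2 1 1)" for t :: nat
  define X where "X = mat 2 k (\<lambda>(r, t). w t $ r)"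
  have X: "X \<in> carrier_mat 2 k" by (simp add: X_def)
  interpret bordered k "ones_col 3" X
    by (rule bordered_ones_col[OF X])
  have w: "w t \<in> carrier_vec 2 - {0\<^sub>v 2}" for t
    unfolding nonzero_vecs_2 w_def by simp
  have col: "col X t = w t" if "t < k" for t
    using that w[of t] by (intro eq_vecI) (auto simp: X_def)
  have "2 + card {t. t < k \<and> col X t = v} \<in> {(q + 3) div 3, (q + 3) div 3 + 1}"
    if "v \<in> carrier_vec 2 - {0\<^sub>v 2}" for v
  proof -
    obtain r where "r < 3" and r: "w t = v \<longleftrightarrow> t mod 3 = r" for t
    proof -
      have "w t = vec2 1 0 \<longleftrightarrow> t mod 3 = 0" "w t = vec2 0 1 \<longleftrightarrow> t mod 3 = 1"
        "w t = vec2 1 1 \<longleftrightarrow> t mod 3 = 2" for t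
        by (auto simp: w_def)
      then show thesis using that[of 0] that[of 1] that[of 2] \<open>v \<in> _\<close> unfolding nonzero_vecs_2
        by auto
    qed
    have "{t. t < k \<and> col X t = v} = {t. t < k \<and> t mod 3 = r}"
      by (intro Collect_cong conj_cong refl) (simp add: col r)
    moreover have "(q + 3) div 3 = 2 + k div 3" using assms by (simp add: k_def)
    ultimately show ?thesis using card_residue_class[OF \<open>r < 3\<close>, of k] by auto
  qed
  then have "admissible_X q (q + 3) X"
    unfolding admissible_X_def PG_points_2
    using X col w appearances_top_block by (auto simp flip: k_def)
  then show ?thesis by blast
qed

lemma generator_d_optimal:
  assumes "5 \<le> q" and adm: "admissible_X q (q + 3) X"
  shows "yields_twofi_optimal_fraction 2 q (q + 3) 1 (generator_d q X)"
proof -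
  define k where "k = q - 3"
  have X: "X \<in> carrier_mat 2 k" and nz: "\<And>t. t < k \<Longrightarrow> col X t \<noteq> 0\<^sub>v 2"
    using adm by (auto simp: admissible_X_def k_def)
  interpret bordered k "ones_col 3" X
    by (rule bordered_ones_col[OF X])
  have "twofi_optimal 2 (3 + k) (6 + k) (bordered_generator k (ones_col 3) X)"
  proof (rule twofi_optimal)
    fix v :: "bit vec" assume v: "v \<in> carrier_vec 2 - {0\<^sub>v 2}"
    then show "2 + card {t. t < k \<and> col X t = v} \<in> {(q + 3) div 3, (q + 3) div 3 + 1}"
      using adm unfolding admissible_X_def PG_points_2 appearances_top_block[OF v, symmetric] by blast
  qed (use null_sets_large_if_core_ones nz assms in \<open>auto simp: k_def ones_col_def\<close>)
  then have "yields_twofi_optimal_fraction 2 (3 + k) (6 + k) 1 (bordered_generator k (ones_col 3) X)"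
    by (rule yields_twofi_optimal_fractionI[OF bordered_ones_col[OF X]])
  moreover have "generator_d q X = bordered_generator k (ones_col 3) X"
    by (simp add: generator_d_def bordered_generator_def k_def)
  moreover have "3 + k = q" "6 + k = q + 3" using assms by (auto simp: k_def)
  ultimately show ?thesis by simp
qed

theorem theorem6:
  fixes p q n :: nat
  assumes "p = 2" and "q \<ge> 2" and "n = p + q + 1"
  shows "(q = 2 \<longrightarrow> yields_twofi_optimal_fraction p q n 1 generator_a) \<and>
    (q = 3 \<longrightarrow> yields_twofi_optimal_fraction p q n 1 generator_b) \<and>
    (q = 4 \<longrightarrow> yields_twofi_optimal_fraction p q n 1 generator_c) \<and>
    (q \<ge> 5 \<longrightarrow> (\<exists>X. admissible_X q n X) \<and>
       (\<forall>X. admissible_X q n X \<longrightarrow> yields_twofi_optimal_fraction p q n 1 (generator_d q X)))"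
proof -
  have n: "n = q + 3" using assms by simp
  show ?thesis
    unfolding n \<open>p = 2\<close> using generator_a_optimal generator_b_optimal generator_c_optimal generator_d_optimal ex_admissible_X by auto
qed

end
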